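(* Let $f\in C^3(\mathbb{T})$ be a non-constant real-valued function. Then, for all $\varphi\in\mathcal{D}_X$ and for each of the limits $t\to+\infty$ and $t\to-\infty$, $$\left(\liminf_{t\to\pm\infty}\frac1t\int_0^t\|T_{f'}e^{iT_fs}\varphi\|^2\,ds\right)^{1/2}\le\liminf_{t\to\pm\infty}\frac{1}{|t|}\|e^{iT_ft}\varphi\|_X,$$ $$\limsup_{t\to\pm\infty}\frac{1}{|t|}\|e^{iT_ft}\varphi\|_X\le\left(\limsup_{t\to\pm\infty}\frac1t\int_0^t\|T_{f'}e^{iT_fs}\varphi\|^2\,ds\right)^{1/2}.$$
   Context: $\mathbb{N}=\{1,2,3,\dots\}$, $\mathbb{T}=\mathbb{R}/2\pi\mathbb{Z}$, and $(e_n)_{n\in\mathbb{N}}$ is the canonical orthonormal basis of the complex Hilbert space $l^2(\mathbb{N})$. For $f\in L^\infty(\mathbb{T})$, $\hat f_n=\frac{1}{2\pi}\int_{\mathbb{T}}e^{-in\theta}f(\theta)\,d\theta$, and the Toeplitz operator $T_f$ is the bounded operator on $l^2(\mathbb{N})$ given by $(T_f\varphi)_n=\sum_{k\in\mathbb{N}}\hat f_{n-k}\varphi_k$; it is self-adjoint for real-valued $f$. $X$ is the self-adjoint position operator $Xe_n=ne_n$ with domain $\mathcal{D}_X=\{\psi\in l^2(\mathbb{N}):\sum_n n^2|\psi_n|^2<\infty\}$, and $\|\psi\|_X=\sqrt{\|\psi\|^2+\|X\psi\|^2}$ for $\psi\in\mathcal{D}_X$. One has $e^{iT_ft}\mathcal{D}_X\subset\mathcal{D}_X$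 for all $t\in\mathbb{R}$. *)

theory Defs
  imports "HOL-Analysis.Analysis"
begin

section \<open>The Hilbert space of square-summable sequences\<close>

text \<open>
  Sequences over \<open>\<nat> = {1, 2, 3, \<dots>}\<close> are indexed by the type \<^typ>\<open>nat\<close>, shifted by one:
  \<open>Rep_ell2 \<phi> n\<close> is the coefficient of \<open>\<phi>\<close> along the basis vector \<open>e\<^bsub>n+1\<^esub>\<close>.  Toeplitz operators
  depend only on differences of indices, so the shift is visible in the position operator only.
\<close>

typedef ell2 = "{\<phi> :: nat \<Rightarrow> complex. summable (\<lambda>n. (cmod (\<phi> n))\<^sup>2)}"
  by (rule exI[of _ "\<lambda>_. 0"]) simp

setup_lifting type_definition_ell2

lemma summable_ell2: "summable (\<lambda>n. (cmod (Rep_ell2 \<phi> n))\<^sup>2)"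
  using Rep_ell2[of \<phi>] by simp

lemma ell2_eqI: "(\<And>n. Rep_ell2 \<phi> n = Rep_ell2 \<psi> n) \<Longrightarrow> \<phi> = \<psi>"
  by (simp add: Rep_ell2_inject[symmetric] fun_eq_iff)

lemma summable_cmod_add:
  assumes "summable (\<lambda>n. (cmod (a n))\<^sup>2)" "summable (\<lambda>n. (cmod (b n))\<^sup>2)"
  shows "summable (\<lambda>n. (cmod (a n + b n))\<^sup>2)"
proof (rule summable_comparison_test')
  show "summable (\<lambda>n. 2 * (cmod (a n))\<^sup>2 + 2 * (cmod (b n))\<^sup>2)"
    by (intro summable_add summable_mult assms)
  fix n :: nat
  have "(cmod (a n + b n))\<^sup>2 \<le> (cmod (a n) + cmod (b n))\<^sup>2"
    by (simp add: norm_triangle_ineq power_mono)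
  also have "\<dots> \<le> 2 * (cmod (a n))\<^sup>2 + 2 * (cmod (b n))\<^sup>2"
    using sum_squares_bound[of "cmod (a n)" "cmod (b n)"] by (simp add: power2_sum)
  finally show "norm ((cmod (a n + b n))\<^sup>2) \<le> 2 * (cmod (a n))\<^sup>2 + 2 * (cmod (b n))\<^sup>2"
    by simp
qed

lemma summable_cmod_scale:
  assumes "summable (\<lambda>n. (cmod (a n))\<^sup>2)"
  shows "summable (\<lambda>n. (cmod (c * a n))\<^sup>2)"
  using summable_mult[OF assms, of "(cmod c)\<^sup>2"] by (simp add: norm_mult power_mult_distrib)

lift_definition cscale :: "complex \<Rightarrow> ell2 \<Rightarrow> ell2" is "\<lambda>c \<phi> n. c * \<phi> n"
  by (rule summable_cmod_scale)

instantiation ell2 :: real_vector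
begin

lift_definition zero_ell2 :: ell2 is "\<lambda>_. 0" by simp

lift_definition plus_ell2 :: "ell2 \<Rightarrow> ell2 \<Rightarrow> ell2" is "\<lambda>\<phi> \<psi> n. \<phi> n + \<psi> n"
  by (rule summable_cmod_add)

lift_definition uminus_ell2 :: "ell2 \<Rightarrow> ell2" is "\<lambda>\<phi> n. - \<phi> n"
  by simp

lift_definition minus_ell2 :: "ell2 \<Rightarrow> ell2 \<Rightarrow> ell2" is "\<lambda>\<phi> \<psi> n. \<phi> n - \<psi> n"
  using summable_cmod_add[of _ "\<lambda>n. - _ n"] by simp

lift_definition scaleR_ell2 :: "real \<Rightarrow> ell2 \<Rightarrow> ell2" is "\<lambda>r \<phi> n. r *\<^sub>R \<phi> n"
  using summable_cmod_scale[of _ "complex_of_real _"] by (simp add: scaleR_conv_of_real)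

instance
  by standard (transfer; simp add: fun_eq_iff algebra_simps)+

end

lemma scaleR_eq_cscale: "r *\<^sub>R \<phi> = cscale (complex_of_real r) \<phi>"
  by transfer (simp add: scaleR_conv_of_real)

lemma summable_inner_ell2: "summable (\<lambda>n. Rep_ell2 \<phi> n \<bullet> Rep_ell2 \<psi> n)"
proof (rule summable_comparison_test')
  show "summable (\<lambda>n. (cmod (Rep_ell2 \<phi> n))\<^sup>2 + (cmod (Rep_ell2 \<psi> n))\<^sup>2)"
    by (intro summable_add summable_ell2)
  fix n :: nat
  have "norm (Rep_ell2 \<phi> n \<bullet> Rep_ell2 \<psi> n) \<le> cmod (Rep_ell2 \<phi> n) * cmod (Rep_ell2 \<psi> n)"
    using Cauchy_Schwarz_ineq2[of "Rep_ell2 \<phi> n" "Rep_ell2 \<psi> n"] by simp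
  also have "\<dots> \<le> (cmod (Rep_ell2 \<phi> n))\<^sup>2 + (cmod (Rep_ell2 \<psi> n))\<^sup>2"
    using sum_squares_bound[of "cmod (Rep_ell2 \<phi> n)" "cmod (Rep_ell2 \<psi> n)"]
      mult_nonneg_nonneg[OF norm_ge_zero[of "Rep_ell2 \<phi> n"] norm_ge_zero[of "Rep_ell2 \<psi> n"]]
    by linarith
  finally show "norm (Rep_ell2 \<phi> n \<bullet> Rep_ell2 \<psi> n)
      \<le> (cmod (Rep_ell2 \<phi> n))\<^sup>2 + (cmod (Rep_ell2 \<psi> n))\<^sup>2" .
qed

text \<open>
  The library has no class of complex inner product spaces.  The real inner product below is the
  real part of the complex one, and induces the same norm.
\<close>

instantiation ell2 :: real_inner
begin

definition inner_ell2 :: "ell2 \<Rightarrow> ell2 \<Rightarrow> real" where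
  "inner_ell2 \<phi> \<psi> = (\<Sum>n. Rep_ell2 \<phi> n \<bullet> Rep_ell2 \<psi> n)"

definition norm_ell2 :: "ell2 \<Rightarrow> real" where
  "norm_ell2 \<phi> = sqrt (\<Sum>n. (cmod (Rep_ell2 \<phi> n))\<^sup>2)"

definition sgn_ell2 :: "ell2 \<Rightarrow> ell2" where
  "sgn_ell2 \<phi> = \<phi> /\<^sub>R norm \<phi>"

definition dist_ell2 :: "ell2 \<Rightarrow> ell2 \<Rightarrow> real" where
  "dist_ell2 \<phi> \<psi> = norm (\<phi> - \<psi>)"

definition uniformity_ell2 :: "(ell2 \<times> ell2) filter" where
  "uniformity_ell2 = (INF e\<in>{0<..}. principal {(\<phi>, \<psi>). dist \<phi> \<psi> < e})"

definition open_ell2 :: "ell2 set \<Rightarrow> bool" where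
  "open_ell2 U \<longleftrightarrow> (\<forall>\<phi>\<in>U. eventually (\<lambda>(\<phi>', \<psi>). \<phi>' = \<phi> \<longrightarrow> \<psi> \<in> U) uniformity)"

instance
proof
  fix \<phi> \<psi> \<eta> :: ell2 and r :: real and U :: "ell2 set"
  show "inner \<phi> \<psi> = inner \<psi> \<phi>"
    by (simp add: inner_ell2_def inner_commute)
  show "inner (\<phi> + \<psi>) \<eta> = inner \<phi> \<eta> + inner \<psi> \<eta>"
    by (simp add: inner_ell2_def plus_ell2.rep_eq inner_add_left suminf_add summable_inner_ell2)
  show "inner (r *\<^sub>R \<phi>) \<psi> = r * inner \<phi> \<psi>"
    by (simp add: inner_ell2_def scaleR_ell2.rep_eq suminf_mult[OF summable_inner_ell2]
        del: complex_scaleR)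
  show "0 \<le> inner \<phi> \<phi>"
    unfolding inner_ell2_def by (intro suminf_nonneg summable_inner_ell2 inner_ge_zero)
  show "inner \<phi> \<phi> = 0 \<longleftrightarrow> \<phi> = 0"
  proof -
    have "inner \<phi> \<phi> = 0 \<longleftrightarrow> (\<forall>n. Rep_ell2 \<phi> n \<bullet> Rep_ell2 \<phi> n = 0)"
      unfolding inner_ell2_def
      by (rule suminf_eq_zero_iff[OF summable_inner_ell2 inner_ge_zero])
    also have "\<dots> \<longleftrightarrow> \<phi> = 0"
      by (auto simp: zero_ell2.rep_eq intro: ell2_eqI)
    finally show ?thesis .
  qed
  show "norm \<phi> = sqrt (inner \<phi> \<phi>)"
    by (simp add: norm_ell2_def inner_ell2_def dot_square_norm)
qed (rule sgn_ell2_def dist_ell2_def uniformity_ell2_def open_ell2_def)+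

end

lemma sum_le_norm_ell2: "(\<Sum>n<N. (cmod (Rep_ell2 \<phi> n))\<^sup>2) \<le> (norm \<phi>)\<^sup>2"
  using sum_le_suminf[OF summable_ell2[of \<phi>], of "{..<N}"]
  by (simp add: norm_ell2_def suminf_nonneg summable_ell2)

lemma cmod_le_norm_ell2: "cmod (Rep_ell2 \<phi> n) \<le> norm \<phi>"
proof (rule power2_le_imp_le)
  have "(cmod (Rep_ell2 \<phi> n))\<^sup>2 \<le> (\<Sum>m<Suc n. (cmod (Rep_ell2 \<phi> m))\<^sup>2)"
    by (simp add: sum_nonneg)
  also have "\<dots> \<le> (norm \<phi>)\<^sup>2" by (rule sum_le_norm_ell2)
  finally show "(cmod (Rep_ell2 \<phi> n))\<^sup>2 \<le> (norm \<phi>)\<^sup>2" .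
qed simp

instance ell2 :: banach
proof
  fix X :: "nat \<Rightarrow> ell2"
  assume X: "Cauchy X"
  have "Cauchy (\<lambda>k. Rep_ell2 (X k) n)" for n
  proof (rule metric_CauchyI)
    fix e :: real assume "e > 0"
    then obtain K where K: "dist (X j) (X k) < e" if "j \<ge> K" "k \<ge> K" for j k
      using metric_CauchyD[OF X] by blast
    have "dist (Rep_ell2 (X j) n) (Rep_ell2 (X k) n) < e" if "j \<ge> K" "k \<ge> K" for j k
      using cmod_le_norm_ell2[of "X j - X k" n] K[OF that]
      by (simp add: dist_norm minus_ell2.rep_eq)
    then show "\<exists>K. \<forall>j\<ge>K. \<forall>k\<ge>K. dist (Rep_ell2 (X j) n) (Rep_ell2 (X k) n) < e" by blast
  qed
  then have "\<forall>n. \<exists>l. (\<lambda>k. Rep_ell2 (X k) n) \<longlonglongrightarrow> l"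
    by (simp add: Cauchy_convergent_iff convergent_def)
  then obtain a where a: "\<And>n. (\<lambda>k. Rep_ell2 (X k) n) \<longlonglongrightarrow> a n" by metis
  have tail: "(\<Sum>n<N. (cmod (Rep_ell2 (X j) n - a n))\<^sup>2) \<le> e\<^sup>2"
    if "\<And>k. k \<ge> K \<Longrightarrow> dist (X j) (X k) < e" for e :: real and j K N
  proof (rule LIMSEQ_le_const2)
    show "(\<lambda>k. \<Sum>n<N. (cmod (Rep_ell2 (X j) n - Rep_ell2 (X k) n))\<^sup>2)
        \<longlonglongrightarrow> (\<Sum>n<N. (cmod (Rep_ell2 (X j) n - a n))\<^sup>2)"
      by (intro tendsto_intros a)
    have "(\<Sum>n<N. (cmod (Rep_ell2 (X j) n - Rep_ell2 (X k) n))\<^sup>2) \<le> e\<^sup>2" if "k \<ge> K" for k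
    proof -
      have "(\<Sum>n<N. (cmod (Rep_ell2 (X j) n - Rep_ell2 (X k) n))\<^sup>2) \<le> (norm (X j - X k))\<^sup>2"
        using sum_le_norm_ell2[of "X j - X k" N] by (simp add: minus_ell2.rep_eq)
      also have "\<dots> \<le> e\<^sup>2"
        using \<open>\<And>k. k \<ge> K \<Longrightarrow> dist (X j) (X k) < e\<close>[OF that]
        by (intro power_mono) (auto simp: dist_norm)
      finally show ?thesis .
    qed
    then show "\<exists>K. \<forall>k\<ge>K. (\<Sum>n<N. (cmod (Rep_ell2 (X j) n - Rep_ell2 (X k) n))\<^sup>2) \<le> e\<^sup>2"
      by blast
  qed
  have diff: "summable (\<lambda>n. (cmod (Rep_ell2 (X j) n - a n))\<^sup>2)"
    if "\<And>k. k \<ge> K \<Longrightarrow> dist (X j) (X k) < e" for e :: real and j K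
    by (rule summableI_nonneg_bounded[where x = "e\<^sup>2"]) (use tail[OF that] in auto)
  obtain K where K: "\<And>j k. j \<ge> K \<Longrightarrow> k \<ge> K \<Longrightarrow> dist (X j) (X k) < 1"
    using metric_CauchyD[OF X, of 1] by auto
  have "summable (\<lambda>n. (cmod (Rep_ell2 (X K) n + - (Rep_ell2 (X K) n - a n)))\<^sup>2)"
    by (intro summable_cmod_add summable_ell2, subst norm_minus_cancel, rule diff[of K K 1])
      (simp add: K)
  then have suma: "summable (\<lambda>n. (cmod (a n))\<^sup>2)" by simp
  then have rep: "Rep_ell2 (Abs_ell2 a) = a" by (simp add: Abs_ell2_inverse)
  have "X \<longlonglongrightarrow> Abs_ell2 a"
  proof (rule metric_LIMSEQ_I)
    fix e :: real assume "e > 0"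
    then obtain K where K: "\<And>j k. j \<ge> K \<Longrightarrow> k \<ge> K \<Longrightarrow> dist (X j) (X k) < e / 2"
      using metric_CauchyD[OF X, of "e / 2"] by auto
    have "dist (X j) (Abs_ell2 a) < e" if "j \<ge> K" for j
    proof -
      have "(\<Sum>n. (cmod (Rep_ell2 (X j) n - a n))\<^sup>2) \<le> (e / 2)\<^sup>2"
        by (rule suminf_le_const[OF diff tail]) (use K that in blast)+
      then have "dist (X j) (Abs_ell2 a) \<le> e / 2"
        using \<open>e > 0\<close> unfolding dist_norm norm_ell2_def minus_ell2.rep_eq rep
        by (intro real_le_lsqrt) (auto intro: suminf_nonneg diff)
      then show ?thesis using \<open>e > 0\<close> by simp
    qed
    then show "\<exists>K. \<forall>j\<ge>K. dist (X j) (Abs_ell2 a) < e" by blast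
  qed
  then show "convergent X" by (auto simp: convergent_def)
qed


section \<open>Toeplitz operators\<close>

text \<open>
  Functions on \<open>\<real>/2\<pi>\<int>\<close> are \<open>2\<pi>\<close>-periodic functions on the real line.
\<close>

definition periodic2pi :: "(real \<Rightarrow> 'a) \<Rightarrow> bool" where
  "periodic2pi f \<longleftrightarrow> (\<forall>\<theta>. f (\<theta> + 2 * pi) = f \<theta>)"

definition C_on_line :: "nat \<Rightarrow> (real \<Rightarrow> real) \<Rightarrow> bool" where
  "C_on_line k f \<longleftrightarrow>
     (\<forall>j<k. \<forall>x. (deriv ^^ j) f differentiable (at x)) \<and> continuous_on UNIV ((deriv ^^ k) f)"

definition C_torus :: "nat \<Rightarrow> (real \<Rightarrow> real) set" where
  "C_torus k = {f. periodic2pi f \<and> C_on_line k f}"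

definition fourier_coeff :: "(real \<Rightarrow> complex) \<Rightarrow> int \<Rightarrow> complex" where
  "fourier_coeff f m =
     1 / (2 * pi) * (LINT \<theta>:{0..2*pi}|lebesgue. exp (- \<i> * of_int m * of_real \<theta>) * f \<theta>)"

text \<open>
  For bounded measurable \<open>f\<close> the series converges absolutely and the resulting sequence is
  square-summable, so \<open>Abs_ell2\<close> is applied within the domain on which it inverts \<open>Rep_ell2\<close>.
\<close>

definition toeplitz :: "(real \<Rightarrow> complex) \<Rightarrow> ell2 \<Rightarrow> ell2" where
  "toeplitz f \<phi> = Abs_ell2 (\<lambda>n. \<Sum>k. fourier_coeff f (int n - int k) * Rep_ell2 \<phi> k)"

text \<open>
  The operator \<open>e\<^bsup>iAt\<^esup>\<close> for a bounded operator \<open>A\<close>, by its exponential series (in the norm of \<open>ell2\<close>).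
\<close>

definition exp_i :: "(ell2 \<Rightarrow> ell2) \<Rightarrow> real \<Rightarrow> ell2 \<Rightarrow> ell2" where
  "exp_i A t \<phi> = (\<Sum>k. cscale ((\<i> * of_real t) ^ k / fact k) ((A ^^ k) \<phi>))"


section \<open>The position operator\<close>

definition dom_X :: "ell2 set" where
  "dom_X = {\<psi>. summable (\<lambda>n. (real (Suc n))\<^sup>2 * (cmod (Rep_ell2 \<psi> n))\<^sup>2)}"

text \<open>Meaningful on \<open>dom_X\<close> only; unspecified elsewhere.\<close>

definition pos_X :: "ell2 \<Rightarrow> ell2" where
  "pos_X \<psi> = Abs_ell2 (\<lambda>n. of_nat (Suc n) * Rep_ell2 \<psi> n)"

lemma Rep_pos_X: "\<psi> \<in> dom_X \<Longrightarrow> Rep_ell2 (pos_X \<psi>) n = of_nat (Suc n) * Rep_ell2 \<psi> n"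
  unfolding pos_X_def dom_X_def
  by (subst Abs_ell2_inverse) (simp_all add: norm_mult power_mult_distrib del: of_nat_Suc)

definition norm_X :: "ell2 \<Rightarrow> real" where
  "norm_X \<psi> = sqrt ((norm \<psi>)\<^sup>2 + (norm (pos_X \<psi>))\<^sup>2)"


section \<open>Square roots of extended real numbers\<close>

definition ereal_sqrt :: "ereal \<Rightarrow> ereal" where
  "ereal_sqrt x = (if \<bar>x\<bar> = \<infinity> then x else ereal (sqrt (real_of_ereal x)))"

end

theory Submission
  imports Defs
begin

text \<open>
  Let \<open>A = T\<^sub>f\<close>, \<open>B = T\<^bsub>f'\<^esub>\<close> and \<open>\<phi>(t) = e\<^bsup>iAt\<^esup> \<phi>\<close>.  As the coefficients of \<open>f'\<close> are \<open>i m\<close> times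
  those of \<open>f\<close>, the commutator of \<open>X\<close> with \<open>A\<close> is \<open>-i B\<close>, and \<open>\<eta>(t) = X \<phi>(t)\<close> satisfies
  \<open>\<eta>' = i A \<eta> + B \<phi>\<close>.  As \<open>A\<close> is self-adjoint, this gives, for the real inner product,

    \<open>(\<parallel>\<eta>\<parallel>\<^sup>2)' = 2 \<eta> \<bullet> B \<phi>\<close>  and  \<open>(\<eta> \<bullet> B \<phi>)' = \<parallel>B \<phi>\<parallel>\<^sup>2 + q\<close>  with  \<open>q = \<eta> \<bullet> i[B,A] \<phi>\<close>

  (\<open>position_growth\<close>).  If \<open>q\<close> has vanishing time average, two integrations compare
  \<open>\<parallel>\<eta>(t)\<parallel>\<^sup>2 / t\<^sup>2\<close> with the time average of \<open>\<parallel>B \<phi>\<parallel>\<^sup>2\<close> (\<open>ballistic_bounds\<close>), and the conserved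
  norm of \<open>\<phi>(t)\<close> disappears after division by \<open>t\<^sup>2\<close>.

  To control \<open>q\<close>, note that Toeplitz operators commute up to products of Hankel operators
  (\<open>toep_commutator\<close>).  The coefficients of \<open>f\<close> and \<open>f'\<close> are of order \<open>1/m\<^sup>2\<close>, which is enough for
  these products to absorb the unbounded factor \<open>X\<close> in \<open>\<eta>\<close> and leaves
  \<open>\<bar>q\<bar> \<le> D (\<Sum>n. a\<^sub>n \<bar>\<phi>\<^sub>n(t)\<bar>)\<^sup>2\<close> with a square-summable weight \<open>a\<close>.  It remains to see that every
  coordinate of \<open>\<phi>(t)\<close> vanishes in quadratic time average (\<open>toep_null_average\<close>).  This follows
  from a positive commutator estimate, which proves it for some directions, and from a
  wandering-vector argument in the style of Beurling, which shows that the images of these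
  directions under the powers of \<open>A\<close> span a dense subspace.
\<close>

section \<open>Orthogonal projections\<close>

text \<open>
  A minimising sequence for the distance to \<open>x\<close> is Cauchy, and its limit is the projection.
\<close>

lemma closed_subspace_projection:
  fixes E :: "'a::{real_inner,complete_space} set"
  assumes E: "subspace E" "closed E"
  obtains p where "p \<in> E" "\<And>y. y \<in> E \<Longrightarrow> y \<bullet> (x - p) = 0"
proof -
  define d where "d = infdist x E"
  have ne: "E \<noteq> {}" using subspace_0[OF E(1)] by auto
  have dle: "d \<le> norm (x - y)" if "y \<in> E" for y
    using infdist_le[OF that, of x] by (simp add: d_def dist_norm)
  have d0: "d \<ge> 0" by (simp add: d_def infdist_nonneg)
  have "\<exists>y\<in>E. norm (x - y) < d + 1 / Suc n" for n
  proof (rule ccontr)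
    assume "\<not> ?thesis"
    then have "d + 1 / Suc n \<le> dist x y" if "y \<in> E" for y
      using that by (force simp: dist_norm)
    then have "d + 1 / Suc n \<le> infdist x E"
      using ne by (auto simp: infdist_def intro: cINF_greatest)
    then show False by (simp add: d_def)
  qed
  then obtain y where y: "\<And>n. y n \<in> E" "\<And>n. norm (x - y n) < d + 1 / Suc n" by metis
  have lim: "(\<lambda>n. norm (x - y n)) \<longlonglongrightarrow> d"
  proof (rule real_tendsto_sandwich[where f = "\<lambda>_. d" and h = "\<lambda>n. d + 1 / Suc n"])
    show "(\<lambda>n. d + 1 / Suc n) \<longlonglongrightarrow> d"
      using tendsto_add[OF tendsto_const LIMSEQ_Suc[OF lim_1_over_n], of d] by simp
    show "\<forall>\<^sub>F n in sequentially. d \<le> norm (x - y n)" using dle y(1) by simp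
    show "\<forall>\<^sub>F n in sequentially. norm (x - y n) \<le> d + 1 / Suc n"
      by (intro always_eventually allI less_imp_le y(2))
  qed simp
  \<comment> \<open>By the parallelogram law, as the midpoint of two points of \<open>E\<close> is no closer to \<open>x\<close> than \<open>d\<close>.\<close>
  have par: "(norm (y m - y n))\<^sup>2 \<le> 2 * (norm (x - y m))\<^sup>2 + 2 * (norm (x - y n))\<^sup>2 - 4 * d\<^sup>2" for m n
  proof -
    have "(1/2) *\<^sub>R (y m + y n) \<in> E" by (intro subspace_scale subspace_add E y)
    then have "d \<le> norm (x - (1/2) *\<^sub>R (y m + y n))" by (rule dle)
    then have "d\<^sup>2 \<le> (norm (x - (1/2) *\<^sub>R (y m + y n)))\<^sup>2" using d0 by (rule power_mono)
    moreover have "(norm (y m - y n))\<^sup>2 + 4 * (norm (x - (1/2) *\<^sub>R (y m + y n)))\<^sup>2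
      = 2 * (norm (x - y m))\<^sup>2 + 2 * (norm (x - y n))\<^sup>2"
      by (simp add: power2_norm_eq_inner algebra_simps inner_commute)
    ultimately show ?thesis by linarith
  qed
  have "Cauchy y"
  proof (rule metric_CauchyI)
    fix e :: real assume "e > 0"
    have "(\<lambda>n. (norm (x - y n))\<^sup>2) \<longlonglongrightarrow> d\<^sup>2" by (intro tendsto_intros lim)
    then have "\<forall>\<^sub>F n in sequentially. (norm (x - y n))\<^sup>2 < d\<^sup>2 + e\<^sup>2 / 4"
      by (rule order_tendstoD) (use \<open>e > 0\<close> in simp)
    then obtain N where N: "\<And>n. n \<ge> N \<Longrightarrow> (norm (x - y n))\<^sup>2 < d\<^sup>2 + e\<^sup>2 / 4"
      by (auto simp: eventually_sequentially)
    have "dist (y m) (y n) < e" if "m \<ge> N" "n \<ge> N" for m n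
    proof -
      have "(norm (y m - y n))\<^sup>2 < e\<^sup>2" using par[of m n] N[OF that(1)] N[OF that(2)] by linarith
      then show ?thesis using \<open>e > 0\<close> by (simp add: dist_norm power2_less_imp_less)
    qed
    then show "\<exists>N. \<forall>m\<ge>N. \<forall>n\<ge>N. dist (y m) (y n) < e" by blast
  qed
  then obtain p where p: "y \<longlonglongrightarrow> p" by (auto simp: Cauchy_convergent_iff convergent_def)
  have pE: "p \<in> E" using E(2) p y(1) by (meson closed_sequentially)
  have "(\<lambda>n. norm (x - y n)) \<longlonglongrightarrow> norm (x - p)" by (intro tendsto_intros p)
  then have dp: "norm (x - p) = d" using lim LIMSEQ_unique by blast
  have "z \<bullet> (x - p) = 0" if "z \<in> E" for z
  proof (rule ccontr)
    assume n0: "z \<bullet> (x - p) \<noteq> 0"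
    then have z: "z \<bullet> z > 0" by auto
    \<comment> \<open>Moving from \<open>p\<close> along \<open>z\<close> by this optimal step would bring it strictly closer to \<open>x\<close>.\<close>
    define r where "r = (z \<bullet> (x - p)) / (z \<bullet> z)"
    have "p + r *\<^sub>R z \<in> E" by (intro subspace_scale subspace_add E pE that)
    then have "(norm (x - p))\<^sup>2 \<le> (norm ((x - p) - r *\<^sub>R z))\<^sup>2"
      using dle[of "p + r *\<^sub>R z"] dp d0 by (simp add: power_mono diff_diff_add)
    also have "\<dots> = (norm (x - p))\<^sup>2 - 2 * r * (z \<bullet> (x - p)) + r\<^sup>2 * (z \<bullet> z)"
      unfolding power2_norm_eq_inner
      by (simp add: algebra_simps inner_commute power2_eq_square)
    also have "\<dots> = (norm (x - p))\<^sup>2 - (z \<bullet> (x - p))\<^sup>2 / (z \<bullet> z)"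
      using z by (simp add: r_def power2_eq_square field_simps)
    finally show False using z n0 by (simp add: divide_le_0_iff zero_less_divide_iff not_le)
  qed
  with pE show ?thesis using that by blast
qed

section \<open>Exponentials of bounded operators\<close>

text \<open>
  The exponential \<open>exp (tL) x\<close>.  It is needed on \<open>ell2\<close>, where it gives the unitary group, and on
  \<open>ell2 \<times> ell2\<close>, where it moves a vector together with its image under the position operator.
\<close>

definition exp_curve :: "('a::banach \<Rightarrow> 'a) \<Rightarrow> real \<Rightarrow> 'a \<Rightarrow> 'a" where
  "exp_curve L t x = (\<Sum>k. (t ^ k / fact k) *\<^sub>R (L ^^ k) x)"

lemma norm_funpow_le:
  fixes L :: "'a::real_normed_vector \<Rightarrow> 'a"
  assumes "\<And>x. norm (L x) \<le> K * norm x" "K \<ge> 0"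
  shows "norm ((L ^^ k) x) \<le> K ^ k * norm x"
proof (induction k)
  case (Suc k)
  have "norm ((L ^^ Suc k) x) \<le> K * norm ((L ^^ k) x)" using assms(1) by simp
  also have "\<dots> \<le> K * (K ^ k * norm x)" by (intro mult_left_mono Suc assms)
  finally show ?case by (simp add: mult.assoc)
qed simp

lemma exp_curve_summable:
  fixes L :: "'a::banach \<Rightarrow> 'a"
  assumes "bounded_linear L"
  shows "summable (\<lambda>k. (t ^ k / fact k) *\<^sub>R (L ^^ k) x)"
proof -
  obtain K where K: "K \<ge> 0" "\<And>x. norm (L x) \<le> K * norm x"
    using bounded_linear.nonneg_bounded[OF assms] by (metis mult.commute)
  show ?thesis
  proof (rule summable_comparison_test')
    show "summable (\<lambda>k. (\<bar>t\<bar> * K) ^ k / fact k * norm x)"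
      using summable_mult2[OF summable_exp[of "\<bar>t\<bar> * K"], of "norm x"]
      by (auto simp: divide_inverse mult_ac)
    show "norm ((t ^ k / fact k) *\<^sub>R (L ^^ k) x) \<le> (\<bar>t\<bar> * K) ^ k / fact k * norm x" for k
      using mult_left_mono[OF norm_funpow_le[OF K(2,1), of k x], of "\<bar>t\<bar> ^ k / fact k"]
      by (simp add: power_abs power_mult_distrib field_simps)
  qed
qed

lemma exp_curve_0 [simp]: "exp_curve L 0 x = x"
proof -
  have "(\<lambda>k. (0 ^ k / fact k) *\<^sub>R (L ^^ k) x) sums (\<Sum>k\<in>{0::nat}. (0 ^ k / fact k) *\<^sub>R (L ^^ k) x)"
    by (rule sums_finite) auto
  then show ?thesis by (simp add: exp_curve_def sums_iff)
qed

lemma exp_curve_intertwine: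
  assumes "bounded_linear P" "bounded_linear L" "\<And>x. P (L x) = L' (P x)"
  shows "P (exp_curve L t x) = exp_curve L' t (P x)"
proof -
  have "P ((L ^^ k) x) = (L' ^^ k) (P x)" for k
    by (induction k) (simp_all add: assms(3))
  then show ?thesis
    unfolding exp_curve_def bounded_linear.suminf[OF assms(1) exp_curve_summable[OF assms(2)]]
    by (simp add: linear_simps(5)[OF assms(1)])
qed

text \<open>
  A closed subspace that is invariant under the generator contains all partial sums of the
  exponential series, hence the whole curve.  The graph of the position operator is such a subspace.
\<close>

lemma exp_curve_closed:
  assumes E: "subspace E" "closed E" and L: "bounded_linear L" "\<And>x. x \<in> E \<Longrightarrow> L x \<in> E"
    and x: "x \<in> E"
  shows "exp_curve L t x \<in> E"
proof -
  have "(L ^^ k) x \<in> E" for k by (induction k) (simp_all add: L x)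
  then have "(\<Sum>k<n. (t ^ k / fact k) *\<^sub>R (L ^^ k) x) \<in> E" for n
    by (intro subspace_sum subspace_scale E)
  moreover have "(\<lambda>n. \<Sum>k<n. (t ^ k / fact k) *\<^sub>R (L ^^ k) x) \<longlonglongrightarrow> exp_curve L t x"
    unfolding exp_curve_def by (rule summable_LIMSEQ[OF exp_curve_summable[OF L(1)]])
  ultimately show ?thesis using E(2) by (meson closed_sequentially)
qed

lemma exp_curve_derivative:
  fixes L :: "'a::banach \<Rightarrow> 'a"
  assumes L: "bounded_linear L"
  shows "((\<lambda>t. exp_curve L t x) has_vector_derivative L (exp_curve L t x)) (at t)"
proof -
  obtain K where K: "K \<ge> 0" "\<And>x. norm (L x) \<le> K * norm x"
    using bounded_linear.nonneg_bounded[OF L] by (metis mult.commute)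
  define R where "R = \<bar>t\<bar> + 1"
  \<comment> \<open>Termwise differentiation needs uniform convergence, available on bounded intervals only.\<close>
  define S where "S = {-R<..<R}"
  define a where "a k = (L ^^ k) x" for k
  define u where "u k s = (s ^ k / fact k) *\<^sub>R a k" for k s
  define u' where "u' k s = (case k of 0 \<Rightarrow> 0 | Suc j \<Rightarrow> (s ^ j / fact j) *\<^sub>R a k)" for k s
  have tS: "t \<in> S" "open S" "convex S" by (auto simp: S_def R_def)
  have du: "(u k has_vector_derivative u' k s) (at s within S)" for k s
  proof (cases k)
    case 0 then show ?thesis by (simp add: u_def [abs_def] u'_def)
  next
    case (Suc j)
    have "((\<lambda>s. s ^ k / fact k) has_real_derivative (s ^ j / fact j)) (at s within S)"
    proof -
      have "((\<lambda>s. s ^ k / fact k) has_real_derivative (real (Suc j) * s ^ j / fact k)) (at s within S)"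
        unfolding Suc using DERIV_cdivide[OF DERIV_pow[of "Suc j" s S], of "fact (Suc j)"] by simp
      moreover have "real (Suc j) * s ^ j / fact k = s ^ j / fact j"
        unfolding Suc fact_Suc of_nat_mult of_nat_fact
        by (rule trans[OF mult_divide_mult_cancel_left_if]) simp
      ultimately show ?thesis by metis
    qed
    from has_vector_derivative_scaleR[OF this has_vector_derivative_const[of "a k"]]
    show ?thesis by (simp add: Suc u_def [abs_def] u'_def)
  qed
  have sums: "(\<lambda>k. u' k s) sums L (exp_curve L s x)" for s
  proof -
    have "(\<lambda>k. L ((s ^ k / fact k) *\<^sub>R a k)) sums L (exp_curve L s x)"
      unfolding exp_curve_def a_def
      by (rule bounded_linear.sums[OF L summable_sums[OF exp_curve_summable[OF L]]])
    then have "(\<lambda>k. u' (Suc k) s) sums L (exp_curve L s x)"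
      by (simp add: u'_def a_def linear_simps(5)[OF L])
    then show ?thesis by (subst (asm) sums_Suc_iff) (simp add: u'_def)
  qed
  define M where "M k = (case k of 0 \<Rightarrow> 0 | Suc j \<Rightarrow> (R * K) ^ j / fact j * (K * norm x))" for k
  have "summable (\<lambda>k. M (Suc k))"
    using summable_mult2[OF summable_exp[of "R * K"], of "K * norm x"]
    by (simp add: M_def divide_inverse mult.commute mult.left_commute)
  then have M: "summable M" by (subst (asm) summable_Suc_iff)
  have bnd: "norm (u' k s) \<le> M k" if "s \<in> S" for k s
  proof (cases k)
    case (Suc j)
    have "norm (a k) \<le> K ^ j * (K * norm x)"
      using norm_funpow_le[OF K(2,1), of k x] by (simp add: a_def Suc mult_ac)
    moreover have "\<bar>s\<bar> ^ j \<le> R ^ j" using that by (intro power_mono) (auto simp: S_def)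
    ultimately have "\<bar>s\<bar> ^ j * norm (a k) \<le> R ^ j * (K ^ j * (K * norm x))"
      by (intro mult_mono) (auto simp: R_def)
    then show ?thesis
      using divide_right_mono[of _ _ "fact j :: real"]
      by (simp add: Suc u'_def M_def power_abs power_mult_distrib mult.assoc)
  qed (simp add: u'_def M_def)
  have unif: "uniform_limit S (\<lambda>n s. \<Sum>k<n. u' k s) (\<lambda>s. L (exp_curve L s x)) sequentially"
  proof -
    have "uniform_limit S (\<lambda>n s. \<Sum>k<n. u' k s) (\<lambda>s. \<Sum>k. u' k s) sequentially"
      by (rule Weierstrass_m_test[OF bnd M])
    then show ?thesis by (simp add: sums_unique[OF sums, symmetric])
  qed
  have "\<exists>g. \<forall>s\<in>S. (\<lambda>k. u k s) sums g s \<and> (g has_derivative (\<lambda>h. h *\<^sub>R L (exp_curve L s x))) (at s within S)"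
  proof (rule has_derivative_series[OF tS(3)])
    show "(u k has_derivative (\<lambda>h. h *\<^sub>R u' k s)) (at s within S)" for k s
      using du unfolding has_vector_derivative_def .
    show "\<forall>\<^sub>F n in sequentially. \<forall>s\<in>S. \<forall>h. norm ((\<Sum>i<n. h *\<^sub>R u' i s) - h *\<^sub>R L (exp_curve L s x)) \<le> e * norm h"
      if "e > 0" for e
      using uniform_limitD[OF unif that]
    proof eventually_elim
      case (elim n)
      show ?case
      proof (intro ballI allI)
        fix s h assume "s \<in> S"
        then have "norm ((\<Sum>i<n. u' i s) - L (exp_curve L s x)) \<le> e"
          using elim by (force simp: dist_norm)
        then have "\<bar>h\<bar> * norm ((\<Sum>i<n. u' i s) - L (exp_curve L s x)) \<le> \<bar>h\<bar> * e"
          by (intro mult_left_mono) auto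
        then show "norm ((\<Sum>i<n. h *\<^sub>R u' i s) - h *\<^sub>R L (exp_curve L s x)) \<le> e * norm h"
          by (simp only: scaleR_sum_right[symmetric] scaleR_diff_right[symmetric] norm_scaleR
              real_norm_def mult.commute)
      qed
    qed
    show "(\<lambda>k. u k t) sums exp_curve L t x"
      unfolding u_def a_def exp_curve_def by (rule summable_sums[OF exp_curve_summable[OF L]])
  qed (use tS in auto)
  then obtain g where g: "\<forall>s\<in>S. (\<lambda>k. u k s) sums g s \<and>
      (g has_derivative (\<lambda>h. h *\<^sub>R L (exp_curve L s x))) (at s within S)" ..
  have eq: "g s = exp_curve L s x" if "s \<in> S" for s
    using bspec[OF g that] by (simp add: sums_iff exp_curve_def u_def a_def)
  have "(g has_vector_derivative L (exp_curve L t x)) (at t)"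
    using bspec[OF g tS(1)] unfolding at_within_open[OF tS(1,2)] has_vector_derivative_def by simp
  then show ?thesis
    by (rule has_vector_derivative_transform_within_open[OF _ tS(2,1) eq])
qed

section \<open>Complex-linear operators on square-summable sequences\<close>

lemma norm_ell2_sq: "(norm \<phi>)\<^sup>2 = (\<Sum>n. (cmod (Rep_ell2 \<phi> n))\<^sup>2)"
  by (simp add: norm_ell2_def suminf_nonneg summable_ell2)

lemma norm_cscale: "norm (cscale z \<phi>) = cmod z * norm \<phi>"
proof -
  have "(\<Sum>n. (cmod (Rep_ell2 (cscale z \<phi>) n))\<^sup>2) = (cmod z)\<^sup>2 * (\<Sum>n. (cmod (Rep_ell2 \<phi> n))\<^sup>2)"
    by (simp add: cscale.rep_eq norm_mult power_mult_distrib suminf_mult[OF summable_ell2])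
  then have "(norm (cscale z \<phi>))\<^sup>2 = (cmod z * norm \<phi>)\<^sup>2"
    by (simp add: norm_ell2_sq power_mult_distrib)
  then show ?thesis by (simp add: power2_eq_iff_nonneg)
qed

lemma cscale_cscale: "cscale z (cscale w \<phi>) = cscale (z * w) \<phi>"
  by (rule ell2_eqI) (simp add: cscale.rep_eq mult.assoc)

lemma cscale_1 [simp]: "cscale 1 \<phi> = \<phi>"
  by (rule ell2_eqI) (simp add: cscale.rep_eq)

lemma cscale_minus1: "cscale (-1) \<phi> = - \<phi>"
  by (rule ell2_eqI) (simp add: cscale.rep_eq uminus_ell2.rep_eq)

lemma bounded_linear_cscale: "bounded_linear (cscale z)"
proof (rule bounded_linear_intro)
  show "norm (cscale z \<phi>) \<le> norm \<phi> * cmod z" for \<phi> by (simp add: norm_cscale mult.commute)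
qed (rule ell2_eqI, simp add: cscale.rep_eq plus_ell2.rep_eq scaleR_ell2.rep_eq scaleR_conv_of_real algebra_simps)+

lemma bounded_linear_cscale_left: "bounded_linear (\<lambda>z. cscale z \<phi>)"
proof (rule bounded_linear_intro)
  show "norm (cscale z \<phi>) \<le> norm z * norm \<phi>" for z by (simp add: norm_cscale)
qed (rule ell2_eqI, simp add: cscale.rep_eq plus_ell2.rep_eq scaleR_ell2.rep_eq scaleR_conv_of_real algebra_simps)+

lemma bounded_linear_coord: "bounded_linear (\<lambda>\<phi>. Rep_ell2 \<phi> n)"
proof (rule bounded_linear_intro)
  show "norm (Rep_ell2 \<phi> n) \<le> norm \<phi> * 1" for \<phi> using cmod_le_norm_ell2[of \<phi> n] by simp
qed (simp_all add: plus_ell2.rep_eq scaleR_ell2.rep_eq)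

lemmas cscale_linear = linear_simps[OF bounded_linear_cscale]
lemmas cscale_left_linear = linear_simps[OF bounded_linear_cscale_left]

lemma cnj_mult_inner: "(z * x) \<bullet> y = x \<bullet> (cnj z * y)" for x y z :: complex
  by (simp add: inner_complex_def algebra_simps)

lemma inner_cscale_left: "cscale z \<phi> \<bullet> \<psi> = \<phi> \<bullet> cscale (cnj z) \<psi>"
  by (simp add: inner_ell2_def cscale.rep_eq cnj_mult_inner)

lift_definition basis :: "nat \<Rightarrow> ell2" is "\<lambda>k n. if n = k then 1 else 0"
proof -
  fix k :: nat
  show "summable (\<lambda>n. (cmod (if n = k then 1 else 0))\<^sup>2)"
    by (rule summable_finite[of "{k}"]) auto
qed

lemma inner_basis: "cscale z (basis k) \<bullet> \<psi> = z \<bullet> Rep_ell2 \<psi> k"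
proof -
  have "(\<lambda>n. Rep_ell2 (cscale z (basis k)) n \<bullet> Rep_ell2 \<psi> n)
    sums (\<Sum>n\<in>{k}. Rep_ell2 (cscale z (basis k)) n \<bullet> Rep_ell2 \<psi> n)"
    by (rule sums_finite) (auto simp: cscale.rep_eq basis.rep_eq)
  then show ?thesis by (simp add: inner_ell2_def cscale.rep_eq basis.rep_eq sums_iff)
qed

lemma basis_expansion: "(\<lambda>N. \<Sum>k<N. cscale (Rep_ell2 \<phi> k) (basis k)) \<longlonglongrightarrow> \<phi>"
proof -
  let ?s = "\<lambda>N. \<Sum>k<N. cscale (Rep_ell2 \<phi> k) (basis k)"
  have rep: "Rep_ell2 (?s N) n = (if n < N then Rep_ell2 \<phi> n else 0)" for N n
  proof -
    have "Rep_ell2 (?s N) n = (\<Sum>k<N. Rep_ell2 (cscale (Rep_ell2 \<phi> k) (basis k)) n)"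
      by (rule linear_sum[OF bounded_linear.linear[OF bounded_linear_coord]])
    also have "\<dots> = (\<Sum>k<N. if k = n then Rep_ell2 \<phi> n else 0)"
      by (intro sum.cong) (auto simp: cscale.rep_eq basis.rep_eq)
    finally show ?thesis by simp
  qed
  have nrm: "(norm (\<phi> - ?s N))\<^sup>2 = (\<Sum>n. (cmod (Rep_ell2 \<phi> n))\<^sup>2) - (\<Sum>n<N. (cmod (Rep_ell2 \<phi> n))\<^sup>2)" for N
  proof -
    have "(\<Sum>n. (cmod (Rep_ell2 (\<phi> - ?s N) n))\<^sup>2)
      = (\<Sum>n. (cmod (Rep_ell2 (\<phi> - ?s N) (n + N)))\<^sup>2) + (\<Sum>n<N. (cmod (Rep_ell2 (\<phi> - ?s N) n))\<^sup>2)"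
      by (rule suminf_split_initial_segment[OF summable_ell2])
    also have "\<dots> = (\<Sum>n. (cmod (Rep_ell2 \<phi> (n + N)))\<^sup>2)"
      by (simp add: minus_ell2.rep_eq rep)
    finally show ?thesis
      unfolding norm_ell2_sq using suminf_split_initial_segment[OF summable_ell2[of \<phi>], of N] by simp
  qed
  have "(\<lambda>N. (norm (\<phi> - ?s N))\<^sup>2) \<longlonglongrightarrow> (\<Sum>n. (cmod (Rep_ell2 \<phi> n))\<^sup>2) - (\<Sum>n. (cmod (Rep_ell2 \<phi> n))\<^sup>2)"
    unfolding nrm by (intro tendsto_intros summable_LIMSEQ summable_ell2)
  then have "(\<lambda>N. sqrt ((norm (\<phi> - ?s N))\<^sup>2)) \<longlonglongrightarrow> sqrt 0" by (intro tendsto_real_sqrt) simp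
  then have "(\<lambda>N. norm (?s N - \<phi>)) \<longlonglongrightarrow> 0" by (simp add: norm_minus_commute)
  then show ?thesis using LIM_zero_cancel tendsto_norm_zero_iff by blast
qed

definition bounded_clinear :: "(ell2 \<Rightarrow> ell2) \<Rightarrow> bool" where
  "bounded_clinear F \<longleftrightarrow> bounded_linear F \<and> (\<forall>z \<phi>. F (cscale z \<phi>) = cscale z (F \<phi>))"

lemma bounded_clinear_compose: "bounded_clinear F \<Longrightarrow> bounded_clinear G \<Longrightarrow> bounded_clinear (\<lambda>\<phi>. F (G \<phi>))"
  by (auto simp: bounded_clinear_def intro: bounded_linear_compose)

lemma bounded_clinear_diff: "bounded_clinear F \<Longrightarrow> bounded_clinear G \<Longrightarrow> bounded_clinear (\<lambda>\<phi>. F \<phi> - G \<phi>)"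
  by (auto simp: bounded_clinear_def cscale_linear intro: bounded_linear_sub)

lemma bounded_clinear_cscale: "bounded_clinear F \<Longrightarrow> bounded_clinear (\<lambda>\<phi>. cscale z (F \<phi>))"
  by (auto simp: bounded_clinear_def cscale_cscale mult.commute intro: bounded_linear_compose[OF bounded_linear_cscale])

lemma bounded_clinear_funpow: "bounded_clinear F \<Longrightarrow> bounded_clinear (F ^^ k)"
  by (induction k) (auto simp: bounded_clinear_def comp_def id_def intro: bounded_linear_compose)

text \<open>
  Operators are compared through their matrix entries, because the partial sums of the expansion
  along the basis are dense.
\<close>

lemma bounded_clinear_eqI:
  assumes F: "bounded_clinear F" and G: "bounded_clinear G" and eq: "\<And>k. F (basis k) = G (basis k)"
  shows "F \<phi> = G \<phi>"
proof -
  let ?s = "\<lambda>N. \<Sum>k<N. cscale (Rep_ell2 \<phi> k) (basis k)"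
  have bl: "bounded_linear F" "bounded_linear G" using F G by (auto simp: bounded_clinear_def)
  have "F (?s N) = G (?s N)" for N
    using F G by (simp add: linear_sum[OF bounded_linear.linear[OF bl(1)]]
        linear_sum[OF bounded_linear.linear[OF bl(2)]] bounded_clinear_def eq)
  moreover have "(\<lambda>N. F (?s N)) \<longlonglongrightarrow> F \<phi>" "(\<lambda>N. G (?s N)) \<longlonglongrightarrow> G \<phi>"
    by (rule bounded_linear.tendsto[OF bl(1) basis_expansion] bounded_linear.tendsto[OF bl(2) basis_expansion])+
  ultimately show ?thesis using LIMSEQ_unique by simp
qed

text \<open>
  The real inner product is the real part of the complex one, so for complex-linear operators this
  is the usual adjoint relation.
\<close>

definition adjoint_pair :: "(ell2 \<Rightarrow> ell2) \<Rightarrow> (ell2 \<Rightarrow> ell2) \<Rightarrow> bool" where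
  "adjoint_pair F G \<longleftrightarrow> (\<forall>\<phi> \<psi>. F \<phi> \<bullet> \<psi> = \<phi> \<bullet> G \<psi>)"

subsection \<open>Shifts and reflections\<close>

text \<open>
  Moving the coefficients of a sequence injectively and dropping the others does not increase the
  norm.  Shifts (constant on the diagonals of a matrix) and reflections (constant on the
  antidiagonals) are of this kind.
\<close>

lemma partial_reindex:
  fixes a :: "nat \<Rightarrow> complex"
  assumes a: "summable (\<lambda>n. (cmod (a n))\<^sup>2)" and g: "inj_on g {n. P n}"
  shows "summable (\<lambda>n. (cmod (if P n then a (g n) else 0))\<^sup>2)"
    and "(\<Sum>n. (cmod (if P n then a (g n) else 0))\<^sup>2) \<le> (\<Sum>n. (cmod (a n))\<^sup>2)"
proof -
  have bnd: "(\<Sum>n<N. (cmod (if P n then a (g n) else 0))\<^sup>2) \<le> (\<Sum>n. (cmod (a n))\<^sup>2)" for N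
  proof -
    have "(\<Sum>n<N. (cmod (if P n then a (g n) else 0))\<^sup>2) = (\<Sum>n\<in>{n\<in>{..<N}. P n}. (cmod (a (g n)))\<^sup>2)"
      by (rule sum.mono_neutral_cong_right) auto
    also have "\<dots> = (\<Sum>m\<in>g ` {n\<in>{..<N}. P n}. (cmod (a m))\<^sup>2)"
      by (subst sum.reindex) (auto intro: inj_on_subset[OF g])
    also have "\<dots> \<le> (\<Sum>n. (cmod (a n))\<^sup>2)"
      by (rule sum_le_suminf[OF a]) auto
    finally show ?thesis .
  qed
  show *: "summable (\<lambda>n. (cmod (if P n then a (g n) else 0))\<^sup>2)"
    by (rule summableI_nonneg_bounded[OF _ bnd]) auto
  show "(\<Sum>n. (cmod (if P n then a (g n) else 0))\<^sup>2) \<le> (\<Sum>n. (cmod (a n))\<^sup>2)"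
    by (rule suminf_le_const[OF * bnd])
qed

lift_definition shift :: "int \<Rightarrow> ell2 \<Rightarrow> ell2" is
  "\<lambda>m \<phi> n. if m \<le> int n then \<phi> (nat (int n - m)) else 0"
  by (rule partial_reindex(1)) (auto simp: inj_on_def)

lift_definition flip :: "nat \<Rightarrow> ell2 \<Rightarrow> ell2" is
  "\<lambda>m \<phi> n. if n \<le> m then \<phi> (m - n) else 0"
  by (rule partial_reindex(1)) (auto simp: inj_on_def)

definition contraction :: "(ell2 \<Rightarrow> ell2) \<Rightarrow> bool" where
  "contraction F \<longleftrightarrow> bounded_clinear F \<and> (\<forall>\<phi>. norm (F \<phi>) \<le> norm \<phi>)"

lemma contractionI:
  assumes "\<And>\<phi> \<psi>. F (\<phi> + \<psi>) = F \<phi> + F \<psi>" "\<And>z \<phi>. F (cscale z \<phi>) = cscale z (F \<phi>)"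
    "\<And>\<phi>. norm (F \<phi>) \<le> norm \<phi>"
  shows "contraction F"
  using assms by (auto simp: contraction_def bounded_clinear_def scaleR_eq_cscale intro!: bounded_linear_intro[where K = 1])

lemma contraction_shift: "contraction (shift m)"
proof (rule contractionI)
  show "norm (shift m \<phi>) \<le> norm \<phi>" for \<phi>
    unfolding norm_ell2_def shift.rep_eq
    by (intro real_sqrt_le_mono partial_reindex(2) summable_ell2) (auto simp: inj_on_def)
qed (rule ell2_eqI, simp add: shift.rep_eq plus_ell2.rep_eq cscale.rep_eq)+

lemma contraction_flip: "contraction (flip m)"
proof (rule contractionI)
  show "norm (flip m \<phi>) \<le> norm \<phi>" for \<phi>
    unfolding norm_ell2_def flip.rep_eq
    by (intro real_sqrt_le_mono partial_reindex(2) summable_ell2) (auto simp: inj_on_def)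
qed (rule ell2_eqI, simp add: flip.rep_eq plus_ell2.rep_eq cscale.rep_eq)+

lemma bounded_clinear_shift: "bounded_clinear (shift m)"
  using contraction_shift by (simp add: contraction_def)

lemma inner_has_sum: "((\<lambda>n. Rep_ell2 \<phi> n \<bullet> Rep_ell2 \<psi> n) has_sum \<phi> \<bullet> \<psi>) UNIV"
proof -
  have "summable (\<lambda>n. norm (Rep_ell2 \<phi> n \<bullet> Rep_ell2 \<psi> n))"
  proof (rule summable_comparison_test')
    show "summable (\<lambda>n. (cmod (Rep_ell2 \<phi> n))\<^sup>2 + (cmod (Rep_ell2 \<psi> n))\<^sup>2)"
      by (intro summable_add summable_ell2)
    show "norm (norm (Rep_ell2 \<phi> n \<bullet> Rep_ell2 \<psi> n)) \<le> (cmod (Rep_ell2 \<phi> n))\<^sup>2 + (cmod (Rep_ell2 \<psi> n))\<^sup>2" for n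
      using Cauchy_Schwarz_ineq2[of "Rep_ell2 \<phi> n" "Rep_ell2 \<psi> n"]
        sum_squares_bound[of "cmod (Rep_ell2 \<phi> n)" "cmod (Rep_ell2 \<psi> n)"]
        mult_nonneg_nonneg[OF norm_ge_zero[of "Rep_ell2 \<phi> n"] norm_ge_zero[of "Rep_ell2 \<psi> n"]]
      by simp
  qed
  then show ?thesis
    unfolding inner_ell2_def by (rule norm_summable_imp_has_sum) (rule summable_sums[OF summable_inner_ell2])
qed

lemma adjoint_partial_reindex:
  assumes F: "\<And>\<phi> n. Rep_ell2 (F \<phi>) n = (if P n then Rep_ell2 \<phi> (g n) else 0)"
    and G: "\<And>\<psi> n. Rep_ell2 (G \<psi>) n = (if Q n then Rep_ell2 \<psi> (h n) else 0)"
    and gh: "\<And>n. P n \<Longrightarrow> Q (g n) \<and> h (g n) = n" "\<And>n. Q n \<Longrightarrow> P (h n) \<and> g (h n) = n"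
  shows "adjoint_pair F G"
  unfolding adjoint_pair_def
proof (intro allI)
  fix \<phi> \<psi>
  let ?u = "\<lambda>n. Rep_ell2 \<phi> (g n) \<bullet> Rep_ell2 \<psi> n"
  have "(?u has_sum F \<phi> \<bullet> \<psi>) {n. P n}"
    by (rule has_sum_cong_neutral[THEN iffD1, OF _ _ _ inner_has_sum]) (auto simp: F)
  moreover have "((\<lambda>n. ?u (h n)) has_sum \<phi> \<bullet> G \<psi>) {n. Q n}"
    by (rule has_sum_cong_neutral[THEN iffD1, OF _ _ _ inner_has_sum]) (auto simp: G gh)
  then have "(?u has_sum \<phi> \<bullet> G \<psi>) {n. P n}"
    by (subst (asm) has_sum_reindex_bij_witness[where i = g and j = h and T = "{n. P n}" and h = ?u]) (auto simp: gh)
  ultimately show "F \<phi> \<bullet> \<psi> = \<phi> \<bullet> G \<psi>" by (rule has_sum_unique)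
qed

lemma adjoint_shift: "adjoint_pair (shift m) (shift (- m))"
  by (rule adjoint_partial_reindex[OF fun_cong[OF shift.rep_eq] fun_cong[OF shift.rep_eq]]) (auto simp: nat_eq_iff)

lemma adjoint_flip: "adjoint_pair (flip m) (flip m)"
  by (rule adjoint_partial_reindex[OF fun_cong[OF flip.rep_eq] fun_cong[OF flip.rep_eq]]) auto

text \<open>
  The side condition excludes a left shift followed by a right shift, which deletes the first
  coefficients.  This defect is the source of the Hankel terms in products of Toeplitz operators.
\<close>

lemma shift_shift: "q \<ge> 0 \<or> p \<le> 0 \<Longrightarrow> shift p (shift q \<phi>) = shift (p + q) \<phi>"
proof (rule ell2_eqI)
  fix n assume "q \<ge> 0 \<or> p \<le> 0"
  then show "Rep_ell2 (shift p (shift q \<phi>)) n = Rep_ell2 (shift (p + q) \<phi>) n"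
    by (cases "p \<le> int n") (auto simp: shift.rep_eq algebra_simps)
qed

lemma shift_0 [simp]: "shift 0 \<phi> = \<phi>"
  by (rule ell2_eqI) (simp add: shift.rep_eq)

subsection \<open>Absolutely convergent combinations of contractions\<close>

text \<open>
  A Toeplitz operator is the series of its symbol against shifts, a Hankel operator the one against
  reflections.  Building both from contractions gives boundedness and adjoints at once.
\<close>

definition op_series :: "('i \<Rightarrow> complex) \<Rightarrow> ('i \<Rightarrow> ell2 \<Rightarrow> ell2) \<Rightarrow> ell2 \<Rightarrow> ell2" where
  "op_series a R \<phi> = (\<Sum>\<^sub>\<infinity>i. cscale (a i) (R i \<phi>))"

context
  fixes a :: "'i \<Rightarrow> complex" and R :: "'i \<Rightarrow> ell2 \<Rightarrow> ell2"
  assumes a: "(\<lambda>i. cmod (a i)) summable_on UNIV" and R: "\<And>i. contraction (R i)"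
begin

lemma op_series_abs_summable: "(\<lambda>i. norm (cscale (a i) (R i \<phi>))) summable_on UNIV"
proof (rule Infinite_Sum.abs_summable_on_comparison_test'[OF summable_on_cmult_left[OF a]])
  show "norm (cscale (a i) (R i \<phi>)) \<le> cmod (a i) * norm \<phi>" for i
    using R[of i] by (simp add: norm_cscale contraction_def mult_left_mono)
qed

lemma op_series_has_sum: "((\<lambda>i. cscale (a i) (R i \<phi>)) has_sum op_series a R \<phi>) UNIV"
  unfolding op_series_def
  by (rule has_sum_infsum[OF abs_summable_summable[OF op_series_abs_summable]])

lemma bounded_clinear_op_series: "bounded_clinear (op_series a R)"
proof -
  have lin: "R i (\<phi> + \<psi>) = R i \<phi> + R i \<psi>" "R i (cscale z \<phi>) = cscale z (R i \<phi>)" for i \<phi> \<psi> z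
    using R[of i] linear_simps(1) by (auto simp: contraction_def bounded_clinear_def)
  have add: "op_series a R (\<phi> + \<psi>) = op_series a R \<phi> + op_series a R \<psi>" for \<phi> \<psi>
    by (rule has_sum_unique[OF op_series_has_sum])
      (simp add: lin cscale_linear has_sum_add op_series_has_sum)
  have sc: "op_series a R (cscale z \<phi>) = cscale z (op_series a R \<phi>)" for z \<phi>
    using has_sum_bounded_linear[OF bounded_linear_cscale op_series_has_sum[of \<phi>], of z]
    by (intro has_sum_unique[OF op_series_has_sum])
      (simp add: lin cscale_cscale comp_def mult.commute)
  have nrm: "norm (op_series a R \<phi>) \<le> norm \<phi> * (\<Sum>\<^sub>\<infinity>i. cmod (a i))" for \<phi>
  proof -
    have "norm (op_series a R \<phi>) \<le> (\<Sum>\<^sub>\<infinity>i. norm (cscale (a i) (R i \<phi>)))"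
      unfolding op_series_def by (rule norm_infsum_bound[OF op_series_abs_summable])
    also have "\<dots> \<le> (\<Sum>\<^sub>\<infinity>i. cmod (a i) * norm \<phi>)"
      using R by (intro infsum_mono op_series_abs_summable summable_on_cmult_left a)
        (simp add: norm_cscale contraction_def mult_left_mono)
    also have "\<dots> = norm \<phi> * (\<Sum>\<^sub>\<infinity>i. cmod (a i))"
      by (simp add: infsum_cmult_left[OF a] mult.commute[of "norm \<phi>"])
    finally show ?thesis .
  qed
  show ?thesis
    unfolding bounded_clinear_def by (auto simp: sc add scaleR_eq_cscale intro!: bounded_linear_intro[OF _ _ nrm])
qed

end

lemma adjoint_op_series:
  assumes a: "(\<lambda>i. cmod (a i)) summable_on UNIV" and R: "\<And>i. contraction (R i)" "\<And>i. contraction (R' i)"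
    "\<And>i. adjoint_pair (R i) (R' i)"
  shows "adjoint_pair (op_series a R) (op_series (\<lambda>i. cnj (a i)) R')"
  unfolding adjoint_pair_def
proof (intro allI)
  fix \<phi> \<psi>
  have a': "(\<lambda>i. cmod (cnj (a i))) summable_on UNIV" using a by simp
  have "((\<lambda>i. cscale (a i) (R i \<phi>) \<bullet> \<psi>) has_sum op_series a R \<phi> \<bullet> \<psi>) UNIV"
    by (rule has_sum_bounded_linear[OF bounded_linear_inner_left op_series_has_sum[OF a R(1)]])
  moreover have "((\<lambda>i. \<phi> \<bullet> cscale (cnj (a i)) (R' i \<psi>)) has_sum \<phi> \<bullet> op_series (\<lambda>i. cnj (a i)) R' \<psi>) UNIV"
    by (rule has_sum_bounded_linear[OF bounded_linear_inner_right op_series_has_sum[OF a' R(2)]])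
  moreover have "cscale (a i) (R i \<phi>) \<bullet> \<psi> = \<phi> \<bullet> cscale (cnj (a i)) (R' i \<psi>)" for i
  proof -
    have "cscale (a i) (R i \<phi>) \<bullet> \<psi> = R i \<phi> \<bullet> cscale (cnj (a i)) \<psi>" by (rule inner_cscale_left)
    also have "\<dots> = \<phi> \<bullet> R' i (cscale (cnj (a i)) \<psi>)" using R(3) by (simp add: adjoint_pair_def)
    finally show ?thesis using R(2) by (simp add: contraction_def bounded_clinear_def)
  qed
  ultimately show "op_series a R \<phi> \<bullet> \<psi> = \<phi> \<bullet> op_series (\<lambda>i. cnj (a i)) R' \<psi>"
    using has_sum_unique by simp
qed

section \<open>Toeplitz and Hankel operators with absolutely summable symbols\<close>

abbreviation l1 :: "('i \<Rightarrow> complex) \<Rightarrow> bool" where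
  "l1 a \<equiv> (\<lambda>i. cmod (a i)) summable_on UNIV"

lemma has_sum_reindexI:
  assumes "(f has_sum s) S"
    and "\<And>x. x \<in> S \<Longrightarrow> j x \<in> T \<and> i (j x) = x" "\<And>y. y \<in> T \<Longrightarrow> i y \<in> S \<and> j (i y) = y"
    and "\<And>y. y \<in> T \<Longrightarrow> f (i y) = g y"
  shows "(g has_sum s) T"
  using has_sum_reindex_bij_witness[where S = T and T = S and i = j and j = i and h = f and g = g] assms by blast

definition toep :: "(int \<Rightarrow> complex) \<Rightarrow> ell2 \<Rightarrow> ell2" where
  "toep a = op_series a shift"

definition hankel :: "(nat \<Rightarrow> complex) \<Rightarrow> ell2 \<Rightarrow> ell2" where
  "hankel h = op_series h flip"

lemma bounded_clinear_toep: "l1 a \<Longrightarrow> bounded_clinear (toep a)"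
  unfolding toep_def by (rule bounded_clinear_op_series[OF _ contraction_shift])

lemma bounded_clinear_hankel: "l1 h \<Longrightarrow> bounded_clinear (hankel h)"
  unfolding hankel_def by (rule bounded_clinear_op_series[OF _ contraction_flip])

lemma adjoint_toep:
  assumes "l1 a"
  shows "adjoint_pair (toep a) (toep (\<lambda>m. cnj (a (- m))))"
proof -
  have "op_series (\<lambda>m. cnj (a m)) (\<lambda>m. shift (- m)) = op_series (\<lambda>m. cnj (a (- m))) shift"
    unfolding op_series_def
    by (intro ext infsum_reindex_bij_witness[where i = uminus and j = uminus]) auto
  moreover have "adjoint_pair (op_series a shift) (op_series (\<lambda>m. cnj (a m)) (\<lambda>m. shift (- m)))"
    by (rule adjoint_op_series[OF assms contraction_shift contraction_shift adjoint_shift])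
  ultimately show ?thesis unfolding toep_def by simp
qed

lemma adjoint_hankel: "l1 h \<Longrightarrow> adjoint_pair (hankel h) (hankel (\<lambda>m. cnj (h m)))"
  unfolding hankel_def
  by (rule adjoint_op_series[OF _ contraction_flip contraction_flip adjoint_flip])

lemma toep_has_sum:
  assumes "l1 a"
  shows "((\<lambda>k. a (int n - int k) * Rep_ell2 \<phi> k) has_sum Rep_ell2 (toep a \<phi>) n) UNIV"
proof -
  have "((\<lambda>m. a m * Rep_ell2 (shift m \<phi>) n) has_sum Rep_ell2 (toep a \<phi>) n) UNIV"
    using has_sum_bounded_linear[OF bounded_linear_coord op_series_has_sum[OF assms contraction_shift]]
    by (simp add: toep_def cscale.rep_eq)
  then have "((\<lambda>m. a m * Rep_ell2 \<phi> (nat (int n - m))) has_sum Rep_ell2 (toep a \<phi>) n) {..int n}"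
    by (rule has_sum_cong_neutral[THEN iffD1, rotated -1]) (auto simp: shift.rep_eq)
  then show ?thesis
    by (rule has_sum_reindexI[
        where j = "\<lambda>m. nat (int n - m)" and i = "\<lambda>k. int n - int k"]) auto
qed

lemma hankel_has_sum:
  assumes "l1 h"
  shows "((\<lambda>k. h (n + k) * Rep_ell2 \<phi> k) has_sum Rep_ell2 (hankel h \<phi>) n) UNIV"
proof -
  have "((\<lambda>m. h m * Rep_ell2 (flip m \<phi>) n) has_sum Rep_ell2 (hankel h \<phi>) n) UNIV"
    using has_sum_bounded_linear[OF bounded_linear_coord op_series_has_sum[OF assms contraction_flip]]
    by (simp add: hankel_def cscale.rep_eq)
  then have "((\<lambda>m. h m * Rep_ell2 \<phi> (m - n)) has_sum Rep_ell2 (hankel h \<phi>) n) {n..}"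
    by (rule has_sum_cong_neutral[THEN iffD1, rotated -1]) (auto simp: flip.rep_eq)
  then show ?thesis
    by (rule has_sum_reindexI[
        where j = "\<lambda>m. m - n" and i = "\<lambda>k. n + k"]) auto
qed

lemma toep_basis: "l1 a \<Longrightarrow> Rep_ell2 (toep a (basis k)) n = a (int n - int k)"
  by (rule has_sum_unique[OF toep_has_sum]) (auto simp: basis.rep_eq intro!: has_sum_finite_neutralI[where B = "{k}"] split: if_splits)

lemma hankel_basis: "l1 h \<Longrightarrow> Rep_ell2 (hankel h (basis k)) n = h (n + k)"
  by (rule has_sum_unique[OF hankel_has_sum]) (auto simp: basis.rep_eq intro!: has_sum_finite_neutralI[where B = "{k}"] split: if_splits)

text \<open>
  For an absolutely summable symbol the matrix series that defines a Toeplitz operator on \<open>ell2\<close>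
  is the coordinate form of the norm-convergent series of shifts.
\<close>

lemma toeplitz_eq_toep:
  assumes "l1 a" "\<And>m. fourier_coeff f m = a m"
  shows "toeplitz f = toep a"
proof
  fix \<phi>
  have "(\<Sum>k. fourier_coeff f (int n - int k) * Rep_ell2 \<phi> k) = Rep_ell2 (toep a \<phi>) n" for n
    using has_sum_imp_sums[OF toep_has_sum[OF assms(1)]] by (simp add: assms(2) sums_iff)
  then show "toeplitz f \<phi> = toep a \<phi>" by (simp add: toeplitz_def Rep_ell2_inverse)
qed

text \<open>
  The coefficients on either side of the diagonal.  Index \<open>j\<close> stands for frequency \<open>j + 1\<close>, since
  the rows and columns that a half-line matrix misses are numbered \<open>-1, -2, \<dots>\<close>.
\<close>

definition pos_tail :: "(int \<Rightarrow> complex) \<Rightarrow> nat \<Rightarrow> complex" where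
  "pos_tail a j = a (int j + 1)"

definition neg_tail :: "(int \<Rightarrow> complex) \<Rightarrow> nat \<Rightarrow> complex" where
  "neg_tail a j = a (- int j - 1)"

lemma l1_reindex:
  assumes "l1 a" "inj g"
  shows "l1 (\<lambda>i. a (g i))"
proof -
  have "(\<lambda>i. cmod (a i)) summable_on range g"
    by (rule summable_on_subset_banach[OF assms(1)]) simp
  then show ?thesis using summable_on_reindex[OF assms(2), of "\<lambda>i. cmod (a i)"] by (simp add: comp_def)
qed

lemma l1_pos_tail: "l1 a \<Longrightarrow> l1 (pos_tail a)"
  unfolding pos_tail_def by (rule l1_reindex) (auto simp: inj_on_def)

lemma l1_neg_tail: "l1 a \<Longrightarrow> l1 (neg_tail a)"
  unfolding neg_tail_def by (rule l1_reindex) (auto simp: inj_on_def)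

text \<open>
  The sum over all integers is the matrix entry of the full convolution.  Its nonnegative part is
  the product of the half-line matrices, its negative part a product of Hankel matrices.
\<close>

lemma toep_product_entry:
  assumes a: "l1 a" and b: "l1 b"
  shows "((\<lambda>l. a (int n - l) * b (l - int k)) has_sum
    Rep_ell2 (toep a (toep b (basis k))) n + Rep_ell2 (hankel (pos_tail a) (hankel (neg_tail b) (basis k))) n) UNIV"
proof -
  let ?g = "\<lambda>l. a (int n - l) * b (l - int k)"
  have "((\<lambda>l. ?g (int l)) has_sum Rep_ell2 (toep a (toep b (basis k))) n) UNIV"
    using toep_has_sum[OF a, of n "toep b (basis k)"] by (simp add: toep_basis b)
  then have 1: "(?g has_sum Rep_ell2 (toep a (toep b (basis k))) n) {0..}"
    by (rule has_sum_reindexI[where j = int and i = nat]) auto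
  have "((\<lambda>j. ?g (- int j - 1)) has_sum Rep_ell2 (hankel (pos_tail a) (hankel (neg_tail b) (basis k))) n) UNIV"
  proof -
    have "pos_tail a (n + j) * Rep_ell2 (hankel (neg_tail b) (basis k)) j = ?g (- int j - 1)" for j
      unfolding hankel_basis[OF l1_neg_tail[OF b]] pos_tail_def neg_tail_def by (simp add: algebra_simps)
    then show ?thesis
      using hankel_has_sum[OF l1_pos_tail[OF a], of n "hankel (neg_tail b) (basis k)"] by simp
  qed
  then have 2: "(?g has_sum Rep_ell2 (hankel (pos_tail a) (hankel (neg_tail b) (basis k))) n) {..<0}"
    by (rule has_sum_reindexI[
        where j = "\<lambda>j. - int j - 1" and i = "\<lambda>l. nat (- l - 1)"]) auto
  have "{0..} \<union> {..<0::int} = UNIV" by auto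
  with has_sum_Un_disjoint[OF 1 2] show ?thesis by (simp add: disjoint_iff)
qed

text \<open>
  Convolution is commutative, so the two Toeplitz products differ only by what is lost at the edge
  of the half-line, the Hankel products.
\<close>

lemma toep_commutator:
  assumes a: "l1 a" and b: "l1 b"
  shows "toep a (toep b \<phi>) - toep b (toep a \<phi>)
    = hankel (pos_tail b) (hankel (neg_tail a) \<phi>) - hankel (pos_tail a) (hankel (neg_tail b) \<phi>)"
proof (rule bounded_clinear_eqI[where F = "\<lambda>\<phi>. toep a (toep b \<phi>) - toep b (toep a \<phi>)"
      and G = "\<lambda>\<phi>. hankel (pos_tail b) (hankel (neg_tail a) \<phi>) - hankel (pos_tail a) (hankel (neg_tail b) \<phi>)"])
  show "bounded_clinear (\<lambda>\<phi>. toep a (toep b \<phi>) - toep b (toep a \<phi>))"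
    by (rule bounded_clinear_diff[OF bounded_clinear_compose bounded_clinear_compose]) (intro bounded_clinear_toep a b)+
  show "bounded_clinear (\<lambda>\<phi>. hankel (pos_tail b) (hankel (neg_tail a) \<phi>) - hankel (pos_tail a) (hankel (neg_tail b) \<phi>))"
    by (rule bounded_clinear_diff[OF bounded_clinear_compose bounded_clinear_compose]) (intro bounded_clinear_hankel l1_pos_tail l1_neg_tail a b)+
  show "toep a (toep b (basis k)) - toep b (toep a (basis k))
    = hankel (pos_tail b) (hankel (neg_tail a) (basis k)) - hankel (pos_tail a) (hankel (neg_tail b) (basis k))" for k
  proof (rule ell2_eqI)
    fix n
    have "((\<lambda>l. a (int n - l) * b (l - int k)) has_sum
      Rep_ell2 (toep b (toep a (basis k))) n + Rep_ell2 (hankel (pos_tail b) (hankel (neg_tail a) (basis k))) n) UNIV"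
      by (rule has_sum_reindexI[OF toep_product_entry[OF b a],
        where j = "\<lambda>l. int n + int k - l" and i = "\<lambda>l. int n + int k - l"]) auto
    from has_sum_unique[OF this toep_product_entry[OF a b]]
    show "Rep_ell2 (toep a (toep b (basis k)) - toep b (toep a (basis k))) n
      = Rep_ell2 (hankel (pos_tail b) (hankel (neg_tail a) (basis k)) - hankel (pos_tail a) (hankel (neg_tail b) (basis k))) n"
      by (simp add: minus_ell2.rep_eq algebra_simps)
  qed
qed

lemma has_sum_nat_shift:
  fixes g :: "nat \<Rightarrow> complex"
  assumes "g 0 = 0"
  shows "(g has_sum s) UNIV \<longleftrightarrow> ((\<lambda>k. g (Suc k)) has_sum s) UNIV"
proof -
  have "(g has_sum s) UNIV \<longleftrightarrow> (g has_sum s) {1..}"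
    using assms by (intro has_sum_cong_neutral) (auto simp: not_less_eq_eq)
  also have "\<dots> \<longleftrightarrow> ((\<lambda>k. g (Suc k)) has_sum s) UNIV"
    by (rule has_sum_reindex_bij_witness[where j = "\<lambda>k. k - 1" and i = Suc]) auto
  finally show ?thesis .
qed

lemma hankel_shift:
  assumes "l1 h"
  shows "hankel h (shift 1 \<psi>) = shift (-1) (hankel h \<psi>)"
proof (rule ell2_eqI)
  fix n
  have "((\<lambda>k. h (n + Suc k) * Rep_ell2 (shift 1 \<psi>) (Suc k)) has_sum Rep_ell2 (hankel h (shift 1 \<psi>)) n) UNIV"
    using hankel_has_sum[OF assms, of n "shift 1 \<psi>"]
    by (subst (asm) has_sum_nat_shift) (auto simp: shift.rep_eq)
  then have "((\<lambda>k. h (Suc n + k) * Rep_ell2 \<psi> k) has_sum Rep_ell2 (hankel h (shift 1 \<psi>)) n) UNIV"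
    by (simp add: shift.rep_eq)
  then have "Rep_ell2 (hankel h (shift 1 \<psi>)) n = Rep_ell2 (hankel h \<psi>) (Suc n)"
    by (rule has_sum_unique[OF _ hankel_has_sum[OF assms]])
  then show "Rep_ell2 (hankel h (shift 1 \<psi>)) n = Rep_ell2 (shift (-1) (hankel h \<psi>)) n"
    by (simp add: shift.rep_eq nat_add_distrib)
qed

text \<open>
  In the rows \<open>n \<ge> 1\<close> a Toeplitz matrix always commutes with the right shift.  The row \<open>0\<close> of the
  difference is the first coefficient of the Hankel image of \<open>\<psi>\<close>.
\<close>

lemma toep_shift_commute:
  assumes "l1 a" "hankel (neg_tail a) \<psi> = 0"
  shows "toep a (shift 1 \<psi>) = shift 1 (toep a \<psi>)"
proof (rule ell2_eqI)
  fix n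
  have "((\<lambda>k. a (int n - int (Suc k)) * Rep_ell2 (shift 1 \<psi>) (Suc k)) has_sum Rep_ell2 (toep a (shift 1 \<psi>)) n) UNIV"
    using toep_has_sum[OF assms(1), of n "shift 1 \<psi>"]
    by (subst (asm) has_sum_nat_shift) (auto simp: shift.rep_eq)
  then have *: "((\<lambda>k. a (int n - 1 - int k) * Rep_ell2 \<psi> k) has_sum Rep_ell2 (toep a (shift 1 \<psi>)) n) UNIV"
    by (simp add: shift.rep_eq algebra_simps)
  show "Rep_ell2 (toep a (shift 1 \<psi>)) n = Rep_ell2 (shift 1 (toep a \<psi>)) n"
  proof (cases n)
    case 0
    have "Rep_ell2 (toep a (shift 1 \<psi>)) n = Rep_ell2 (hankel (neg_tail a) \<psi>) 0"
    proof (rule has_sum_unique[OF *])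
      show "((\<lambda>k. a (int n - 1 - int k) * Rep_ell2 \<psi> k) has_sum Rep_ell2 (hankel (neg_tail a) \<psi>) 0) UNIV"
      proof -
        have "neg_tail a (0 + k) = a (int n - 1 - int k)" for k
          by (auto simp: neg_tail_def 0 intro: arg_cong[where f = a])
        then show ?thesis
          using hankel_has_sum[OF l1_neg_tail[OF assms(1)], of 0 \<psi>] by (simp only:)
      qed
    qed
    then show ?thesis by (simp add: assms(2) shift.rep_eq zero_ell2.rep_eq 0)
  next
    case (Suc m)
    have "Rep_ell2 (toep a (shift 1 \<psi>)) n = Rep_ell2 (toep a \<psi>) m"
      using * unfolding Suc by (intro has_sum_unique[OF _ toep_has_sum[OF assms(1)]]) simp
    then show ?thesis by (simp add: shift.rep_eq Suc)
  qed
qed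

section \<open>A wandering-vector argument\<close>

lemma inner_shift_shift:
  assumes "n \<ge> 0"
  shows "shift n \<phi> \<bullet> shift m \<psi> = shift (n - m) \<phi> \<bullet> \<psi>"
proof -
  have "shift n \<phi> \<bullet> shift m \<psi> = shift (- m) (shift n \<phi>) \<bullet> \<psi>"
    using adjoint_shift[of "- m"] by (simp add: adjoint_pair_def)
  then show ?thesis using assms by (simp add: shift_shift)
qed

text \<open>
  This is Beurling's argument.  Let \<open>S\<close> be the right shift.  If \<open>M \<noteq> 0\<close>, then \<open>S M \<noteq> M\<close>, because
  the least index at which some element of \<open>M\<close> does not vanish increases under \<open>S\<close>; so there is
  \<open>\<omega> \<noteq> 0\<close> in \<open>M\<close> orthogonal to \<open>S M\<close>.  All shifts of \<open>\<omega>\<close> are then mutually orthogonal, and the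
  inner product of \<open>T\<^sub>c \<omega>\<close> with \<open>S\<^sup>n \<omega>\<close> is \<open>c n\<close> times the squared norm of \<open>\<omega>\<close>.  But \<open>T\<^sub>c\<close> is
  self-adjoint and commutes with \<open>S\<close> on \<open>M\<close>, so this inner product is also that of \<open>\<omega>\<close> with
  \<open>S\<^sup>n T\<^sub>c \<omega>\<close>, an element of \<open>S M\<close>, and vanishes.
\<close>

lemma toep_invariant_subspace_trivial:
  assumes c: "l1 c" and herm: "\<And>m. c (- m) = cnj (c m)" and n: "n \<ge> 1" "c n \<noteq> 0"
    and M: "subspace M" "closed M" "\<And>z \<psi>. \<psi> \<in> M \<Longrightarrow> cscale z \<psi> \<in> M"
    and inv: "\<And>\<psi>. \<psi> \<in> M \<Longrightarrow> shift 1 \<psi> \<in> M" "\<And>\<psi>. \<psi> \<in> M \<Longrightarrow> toep c \<psi> \<in> M"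
      "\<And>\<psi>. \<psi> \<in> M \<Longrightarrow> toep c (shift 1 \<psi>) = shift 1 (toep c \<psi>)"
    and \<phi>: "\<phi> \<in> M"
  shows "\<phi> = 0"
proof (rule ccontr)
  assume "\<phi> \<noteq> 0"
  then obtain k where "Rep_ell2 \<phi> k \<noteq> 0"
    using ell2_eqI[of \<phi> 0] by (auto simp: zero_ell2.rep_eq)
  with \<phi> have ex: "\<exists>k. \<exists>\<psi>\<in>M. Rep_ell2 \<psi> k \<noteq> 0" by blast
  define d where "d = (LEAST k. \<exists>\<psi>\<in>M. Rep_ell2 \<psi> k \<noteq> 0)"
  obtain \<psi> where \<psi>: "\<psi> \<in> M" "Rep_ell2 \<psi> d \<noteq> 0"
    using LeastI_ex[OF ex] unfolding d_def by blast
  have least: "Rep_ell2 \<xi> k = 0" if "\<xi> \<in> M" "k < d" for \<xi> k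
    using not_less_Least[of k "\<lambda>k. \<exists>\<psi>\<in>M. Rep_ell2 \<psi> k \<noteq> 0"] that unfolding d_def by blast
  have bl: "bounded_linear (shift m)" for m using bounded_clinear_shift[of m] by (simp add: bounded_clinear_def)
  have sc: "shift m (cscale z \<xi>) = cscale z (shift m \<xi>)" for m z \<xi>
    using bounded_clinear_shift[of m] by (simp add: bounded_clinear_def)
  \<comment> \<open>\<open>E\<close> is the image of \<open>M\<close> under the right shift, written as a preimage so that it is visibly closed.\<close>
  define E where "E = {\<xi>. shift 1 (shift (-1) \<xi>) = \<xi> \<and> shift (-1) \<xi> \<in> M}"
  have E: "subspace E"
    using M(1) by (auto simp: E_def subspace_def linear_simps[OF bl])
  have "closed {\<xi>. shift 1 (shift (-1) \<xi>) = \<xi>}"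
    by (rule closed_Collect_eq[OF linear_continuous_on[OF bounded_linear_compose[OF bl bl]] continuous_on_id])
  moreover have "closed {\<xi>. shift (-1) \<xi> \<in> M}"
    using closed_vimage[OF M(2), of "shift (-1)"] linear_continuous_on[OF bl] by (auto simp: vimage_def)
  ultimately have E2: "closed E" unfolding E_def by (rule closed_Collect_conj)
  obtain p where p: "p \<in> E" "\<And>y. y \<in> E \<Longrightarrow> y \<bullet> (\<psi> - p) = 0"
    using closed_subspace_projection[OF E E2, of \<psi>] by blast
  define \<omega> where "\<omega> = \<psi> - p"
  have "p \<in> M" using p(1) inv(1)[of "shift (-1) p"] by (simp add: E_def)
  then have \<omega>M: "\<omega> \<in> M" unfolding \<omega>_def by (intro subspace_diff M \<psi>)
  have "\<omega> \<noteq> 0"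
  proof
    assume "\<omega> = 0"
    then have "shift 1 (shift (-1) \<psi>) = \<psi>" "shift (-1) \<psi> \<in> M" using p(1) by (auto simp: \<omega>_def E_def)
    then have "Rep_ell2 \<psi> d = (if 1 \<le> int d then Rep_ell2 (shift (-1) \<psi>) (nat (int d - 1)) else 0)"
      by (metis shift.rep_eq)
    then show False using \<psi>(2) least[OF \<open>shift (-1) \<psi> \<in> M\<close>, of "nat (int d - 1)"] by (auto split: if_splits)
  qed
  have shM: "shift (int j) \<xi> \<in> M \<and> toep c (shift (int j) \<xi>) = shift (int j) (toep c \<xi>)" if "\<xi> \<in> M" for j \<xi>
  proof (induction j)
    case (Suc j)
    have e: "shift (int (Suc j)) \<eta> = shift 1 (shift (int j) \<eta>)" for \<eta> by (simp add: shift_shift)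
    show ?case unfolding e using Suc inv by simp
  qed (simp add: that)
  have wander: "shift m \<xi> \<bullet> \<omega> = 0" if "m \<ge> 1" "\<xi> \<in> M" for m \<xi>
  proof -
    have "shift (m - 1) \<xi> \<in> M" using shM[OF that(2), of "nat (m - 1)"] that(1) by simp
    then have "shift m \<xi> \<in> E" using that(1) by (simp add: E_def shift_shift)
    then show ?thesis unfolding \<omega>_def by (rule p(2))
  qed
  have wander': "shift m (cscale z \<omega>) \<bullet> cscale w \<omega> = 0" if "m \<ge> 1" for m z w
  proof -
    have "shift m (cscale z \<omega>) \<bullet> cscale w \<omega> = shift m (cscale (cnj w * z) \<omega>) \<bullet> \<omega>"
      using inner_cscale_left[of "cnj w"] by (simp add: sc flip: cscale_cscale)
    then show ?thesis using wander[OF that M(3)[OF \<omega>M]] by simp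
  qed
  \<comment> \<open>The scalar \<open>c n\<close> makes the real inner product below equal to \<open>\<bar>c n\<bar>\<^sup>2\<close> times the squared norm.\<close>
  let ?x = "shift n (cscale (c n) \<omega>)"
  have selfadj: "toep c \<xi> \<bullet> \<eta> = \<xi> \<bullet> toep c \<eta>" for \<xi> \<eta>
    using adjoint_toep[OF c] by (simp add: adjoint_pair_def herm)
  have "?x \<bullet> toep c \<omega> = toep c ?x \<bullet> \<omega>" by (simp add: selfadj)
  also have "toep c ?x = shift n (toep c (cscale (c n) \<omega>))"
    using shM[OF M(3)[OF \<omega>M], of "nat n"] n(1) by simp
  also have "\<dots> \<bullet> \<omega> = 0" by (intro wander n inv M \<omega>M)
  finally have 0: "?x \<bullet> toep c \<omega> = 0" .
  have "((\<lambda>m. ?x \<bullet> cscale (c m) (shift m \<omega>)) has_sum ?x \<bullet> toep c \<omega>) UNIV"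
    unfolding toep_def
    by (rule has_sum_bounded_linear[OF bounded_linear_inner_right op_series_has_sum[OF c contraction_shift]])
  moreover have "((\<lambda>m. ?x \<bullet> cscale (c m) (shift m \<omega>)) has_sum ?x \<bullet> cscale (c n) (shift n \<omega>)) UNIV"
  proof (rule has_sum_finite_neutralI[where B = "{n}"])
    fix m assume "m \<in> UNIV - {n}"
    then consider "m < n" | "m > n" by fastforce
    then show "?x \<bullet> cscale (c m) (shift m \<omega>) = 0"
    proof cases
      case 1
      then show ?thesis
        using n(1) wander'[of "n - m"] by (simp add: inner_shift_shift flip: sc)
    next
      case 2
      have "?x \<bullet> cscale (c m) (shift m \<omega>) = shift m (cscale (c m) \<omega>) \<bullet> ?x" by (simp add: inner_commute sc)
      then show ?thesis
        using 2 n(1) wander'[of "m - n"] by (simp add: inner_shift_shift)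
    qed
  qed auto
  ultimately have "?x \<bullet> cscale (c n) (shift n \<omega>) = 0" using 0 has_sum_unique by metis
  then have "cscale (c n) \<omega> \<bullet> cscale (c n) \<omega> = 0"
    using n(1) by (simp add: inner_shift_shift flip: sc)
  then have "cmod (c n) * norm \<omega> = 0" by (simp add: norm_cscale[symmetric])
  then show False using n(2) \<open>\<omega> \<noteq> 0\<close> by simp
qed

section \<open>Unitary groups and time averages\<close>

abbreviation unitary_group :: "(ell2 \<Rightarrow> ell2) \<Rightarrow> real \<Rightarrow> ell2 \<Rightarrow> ell2" where
  "unitary_group A t \<phi> \<equiv> exp_curve (\<lambda>\<psi>. cscale \<i> (A \<psi>)) t \<phi>"

lemma exp_i_eq:
  assumes "bounded_clinear A"
  shows "exp_i A t \<phi> = unitary_group A t \<phi>"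
proof -
  have A: "A (cscale z \<psi>) = cscale z (A \<psi>)" for z \<psi> using assms by (simp add: bounded_clinear_def)
  have "((\<lambda>\<psi>. cscale \<i> (A \<psi>)) ^^ k) \<phi> = cscale (\<i> ^ k) ((A ^^ k) \<phi>)" for k
    by (induction k) (simp_all add: A cscale_cscale)
  then show ?thesis
    unfolding exp_i_def exp_curve_def
    by (simp add: scaleR_eq_cscale cscale_cscale power_mult_distrib mult.commute)
qed

context
  fixes A :: "ell2 \<Rightarrow> ell2"
  assumes A: "bounded_clinear A" and selfadj: "adjoint_pair A A"
begin

lemma bounded_linear_iA: "bounded_linear (\<lambda>\<psi>. cscale \<i> (A \<psi>))"
  using bounded_clinear_cscale[OF A] by (simp add: bounded_clinear_def)

lemma unitary_group_derivative:
  "((\<lambda>t. unitary_group A t \<phi>) has_vector_derivative cscale \<i> (A (unitary_group A t \<phi>))) (at t)"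
  by (rule exp_curve_derivative[OF bounded_linear_iA])

lemma continuous_unitary_group: "continuous_on S (\<lambda>t. unitary_group A t \<phi>)"
  by (rule continuous_at_imp_continuous_on)
    (use unitary_group_derivative has_vector_derivative_continuous in blast)

lemma iA_skew: "cscale \<i> (A \<phi>) \<bullet> \<psi> = \<phi> \<bullet> cscale (- \<i>) (A \<psi>)"
  using A selfadj by (simp add: inner_cscale_left adjoint_pair_def bounded_clinear_def)

lemma iA_self: "cscale \<i> (A \<phi>) \<bullet> \<phi> = 0"
proof -
  have "cscale \<i> (A \<phi>) \<bullet> \<phi> = \<phi> \<bullet> - cscale \<i> (A \<phi>)"
    unfolding iA_skew using cscale_left_linear(4)[of \<i>] by simp
  then show ?thesis by (simp add: inner_commute)
qed

lemma norm_unitary_group: "norm (unitary_group A t \<phi>) = norm \<phi>"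
proof -
  have "((\<lambda>t. unitary_group A t \<phi> \<bullet> unitary_group A t \<phi>) has_vector_derivative 0) (at t)" for t
    using bounded_bilinear.has_vector_derivative[OF bounded_bilinear_inner
        unitary_group_derivative[of \<phi> t] unitary_group_derivative[of \<phi> t]]
    by (simp add: iA_self inner_commute[of _ "cscale \<i> _"])
  then have "((\<lambda>t. unitary_group A t \<phi> \<bullet> unitary_group A t \<phi>) has_real_derivative 0) (at t)" for t
    by (simp add: has_real_derivative_iff_has_vector_derivative)
  then have "unitary_group A t \<phi> \<bullet> unitary_group A t \<phi> = unitary_group A 0 \<phi> \<bullet> unitary_group A 0 \<phi>"
    using DERIV_isconst_all[of "\<lambda>t. unitary_group A t \<phi> \<bullet> unitary_group A t \<phi>"] by blast
  then show ?thesis by (simp add: norm_eq_sqrt_inner)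
qed

lemma unitary_group_commute:
  assumes F: "bounded_clinear F" and comm: "\<And>\<psi>. F (A \<psi>) = A (F \<psi>)"
  shows "F (unitary_group A t \<phi>) = unitary_group A t (F \<phi>)"
proof (rule exp_curve_intertwine[OF _ bounded_linear_iA])
  show "bounded_linear F" using F by (simp add: bounded_clinear_def)
  show "F (cscale \<i> (A \<psi>)) = cscale \<i> (A (F \<psi>))" for \<psi>
    using F comm by (simp add: bounded_clinear_def)
qed

text \<open>
  The quantity \<open>\<psi> \<bullet> i L \<psi>\<close> is bounded along the unitary group, and its time derivative is the
  form of the commutator of \<open>A\<close> with \<open>L\<close>.  A positive commutator therefore has a bounded time
  integral (the method of Putnam and Kato).
\<close>

lemma commutator_smoothing:
  assumes L: "bounded_clinear L" and H: "bounded_clinear H"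
    and pos: "\<And>\<psi>. \<psi> \<bullet> (A (L \<psi>) - L (A \<psi>)) = (norm (H \<psi>))\<^sup>2"
  obtains K where "\<And>t. t \<ge> 0 \<Longrightarrow> integral {0..t} (\<lambda>s. (norm (H (unitary_group A s \<phi>)))\<^sup>2) \<le> K"
proof -
  let ?u = "\<lambda>s. unitary_group A s \<phi>"
  define F where "F s = ?u s \<bullet> cscale \<i> (L (?u s))" for s
  have blL: "bounded_linear (\<lambda>\<psi>. cscale \<i> (L \<psi>))" using bounded_clinear_cscale[OF L] by (simp add: bounded_clinear_def)
  have Lc: "L (cscale z \<psi>) = cscale z (L \<psi>)" for z \<psi> using L by (simp add: bounded_clinear_def)
  have Ac: "A (cscale z \<psi>) = cscale z (A \<psi>)" for z \<psi> using A by (simp add: bounded_clinear_def)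
  have dF: "(F has_vector_derivative (norm (H (?u s)))\<^sup>2) (at s within S)" for s S
  proof -
    have d1: "((\<lambda>s. cscale \<i> (L (?u s))) has_vector_derivative cscale \<i> (L (cscale \<i> (A (?u s))))) (at s)"
      by (rule bounded_linear.has_vector_derivative[OF blL unitary_group_derivative])
    have "(F has_vector_derivative ?u s \<bullet> cscale \<i> (L (cscale \<i> (A (?u s))))
        + cscale \<i> (A (?u s)) \<bullet> cscale \<i> (L (?u s))) (at s)"
      unfolding F_def [abs_def]
      by (rule bounded_bilinear.has_vector_derivative[OF bounded_bilinear_inner unitary_group_derivative d1])
    also have "?u s \<bullet> cscale \<i> (L (cscale \<i> (A (?u s)))) + cscale \<i> (A (?u s)) \<bullet> cscale \<i> (L (?u s))
        = ?u s \<bullet> (A (L (?u s)) - L (A (?u s)))"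
      unfolding iA_skew by (simp add: Lc Ac cscale_cscale cscale_minus1 inner_diff_right)
    finally show ?thesis unfolding pos by (rule has_vector_derivative_at_within)
  qed
  obtain C where C: "\<And>\<psi>. norm (cscale \<i> (L \<psi>)) \<le> norm \<psi> * C" "C \<ge> 0"
    using bounded_linear.nonneg_bounded[OF blL] by blast
  have Fb: "\<bar>F s\<bar> \<le> norm \<phi> * (norm \<phi> * C)" for s
    using Cauchy_Schwarz_ineq2[of "?u s" "cscale \<i> (L (?u s))"]
      mult_left_mono[OF C(1)[of "?u s"], of "norm \<phi>"]
    by (simp add: F_def norm_unitary_group)
  have "integral {0..t} (\<lambda>s. (norm (H (?u s)))\<^sup>2) \<le> 2 * (norm \<phi> * (norm \<phi> * C))" if "t \<ge> 0" for t
  proof -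
    have "((\<lambda>s. (norm (H (?u s)))\<^sup>2) has_integral (F t - F 0)) {0..t}"
      by (rule fundamental_theorem_of_calculus[OF that dF])
    then show ?thesis using Fb[of t] Fb[of 0] by (simp add: integral_unique)
  qed
  then show ?thesis using that by blast
qed

end

subsection \<open>Functions with vanishing time average\<close>

text \<open>
  Continuity is included so that all the integrals exist.
\<close>

definition null_average :: "(real \<Rightarrow> real) \<Rightarrow> bool" where
  "null_average q \<longleftrightarrow> continuous_on UNIV q \<and> ((\<lambda>t. integral {0..t} q / t) \<longlongrightarrow> 0) at_top"

lemma continuous_integrable: "continuous_on UNIV q \<Longrightarrow> q integrable_on {a..b::real}"
  for q :: "real \<Rightarrow> real"
  by (rule integrable_continuous_interval[OF continuous_on_subset]) auto

text \<open>
  The comparison function may depend on the tolerance.  This is what allows infinite sums to be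
  cut off.
\<close>

lemma null_averageI:
  assumes q: "continuous_on UNIV q"
    and approx: "\<And>e. e > 0 \<Longrightarrow> \<exists>q'. null_average q' \<and> (\<forall>s. \<bar>q s\<bar> \<le> q' s + e)"
  shows "null_average q"
  unfolding null_average_def
proof (intro conjI q tendstoI)
  fix e :: real assume "e > 0"
  then obtain q' where q': "null_average q'" "\<And>s. \<bar>q s\<bar> \<le> q' s + e / 2"
    using approx[of "e / 2"] by auto
  have "((\<lambda>t. integral {0..t} q' / t) \<longlongrightarrow> 0) at_top" using q'(1) by (simp add: null_average_def)
  then have "\<forall>\<^sub>F t in at_top. integral {0..t} q' / t < e / 2"
    by (rule order_tendstoD) (use \<open>e > 0\<close> in simp)
  with eventually_gt_at_top[of 0]
  show "\<forall>\<^sub>F t in at_top. dist (integral {0..t} q / t) 0 < e"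
  proof eventually_elim
    case (elim t)
    have i: "q integrable_on {0..t}" "q' integrable_on {0..t}"
      using q q'(1) by (simp_all add: null_average_def continuous_integrable)
    have i': "(\<lambda>s. q' s + e / 2) integrable_on {0..t}"
      by (rule integrable_add[OF i(2) integrable_const_ivl])
    have "norm (integral {0..t} q) \<le> integral {0..t} (\<lambda>s. q' s + e / 2)"
      by (rule integral_norm_bound_integral[OF i(1) i']) (use q'(2) in simp)
    also have "\<dots> = integral {0..t} q' + t * (e / 2)"
      unfolding integral_add[OF i(2) integrable_const_ivl] using elim(1) by simp
    finally have "\<bar>integral {0..t} q\<bar> \<le> integral {0..t} q' + t * (e / 2)" by simp
    from divide_right_mono[OF this, of t] have "\<bar>integral {0..t} q\<bar> / t \<le> integral {0..t} q' / t + e / 2"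
      using elim(1) by (simp add: add_divide_distrib)
    then have "\<bar>integral {0..t} q\<bar> / t < e" using elim(2) by linarith
    then show ?case using elim(1) by (simp add: dist_real_def)
  qed
qed

lemma null_average_dominated:
  assumes "continuous_on UNIV q" "null_average q'" "\<And>s. \<bar>q s\<bar> \<le> q' s"
  shows "null_average q"
proof (rule null_averageI[OF assms(1)])
  fix e :: real assume "e > 0"
  then have "\<bar>q s\<bar> \<le> q' s + e" for s using assms(3)[of s] by simp
  with assms(2) show "\<exists>q'. null_average q' \<and> (\<forall>s. \<bar>q s\<bar> \<le> q' s + e)" by blast
qed

lemma null_average_add:
  assumes "null_average p" "null_average q"
  shows "null_average (\<lambda>s. p s + q s)"
proof -
  have pq: "continuous_on UNIV p" "continuous_on UNIV q"
    "((\<lambda>t. integral {0..t} p / t) \<longlongrightarrow> 0) at_top" "((\<lambda>t. integral {0..t} q / t) \<longlongrightarrow> 0) at_top"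
    using assms by (simp_all add: null_average_def)
  have "integral {0..t} (\<lambda>s. p s + q s) / t = integral {0..t} p / t + integral {0..t} q / t" for t
    by (simp add: integral_add continuous_integrable pq add_divide_distrib)
  then show ?thesis
    using tendsto_add[OF pq(3,4)] by (simp add: null_average_def continuous_on_add pq)
qed

lemma null_average_cmult:
  assumes "null_average q"
  shows "null_average (\<lambda>s. r * q s)"
proof -
  have q: "continuous_on UNIV q" "((\<lambda>t. integral {0..t} q / t) \<longlongrightarrow> 0) at_top"
    using assms by (simp_all add: null_average_def)
  have "integral {0..t} (\<lambda>s. r * q s) / t = r * (integral {0..t} q / t)" for t by simp
  then show ?thesis
    using tendsto_mult_left[OF q(2), of r] by (simp add: null_average_def continuous_on_mult_left q)
qed

lemma null_average_0: "null_average (\<lambda>_. 0)"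
  by (simp add: null_average_def)

lemma null_average_sum:
  "(\<And>i. i \<in> I \<Longrightarrow> null_average (q i)) \<Longrightarrow> null_average (\<lambda>s. \<Sum>i\<in>I. q i s)"
  by (induction I rule: infinite_finite_induct) (auto simp: null_average_0 intro: null_average_add)

lemma null_average_bounded_integral:
  assumes "continuous_on UNIV q" "\<And>s. q s \<ge> 0" "\<And>t. t \<ge> 0 \<Longrightarrow> integral {0..t} q \<le> K"
  shows "null_average q"
proof -
  have "((\<lambda>t. integral {0..t} q / t) \<longlongrightarrow> 0) at_top"
  proof (rule real_tendsto_sandwich)
    show "\<forall>\<^sub>F t in at_top. 0 \<le> integral {0..t} q / t"
      using eventually_gt_at_top[of 0]
      by eventually_elim (auto intro!: divide_nonneg_pos integral_nonneg continuous_integrable assms)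
    show "\<forall>\<^sub>F t in at_top. integral {0..t} q / t \<le> K / t"
      using eventually_gt_at_top[of 0]
      by eventually_elim (auto intro!: divide_right_mono assms)
    show "((\<lambda>t. K / t) \<longlongrightarrow> 0) at_top"
      by (rule tendsto_divide_0[OF tendsto_const filterlim_at_top_imp_at_infinity[OF filterlim_ident]])
  qed simp
  with assms(1) show ?thesis by (simp add: null_average_def)
qed

subsection \<open>Escape of coefficients\<close>

lemma hankel_0: "hankel (\<lambda>_. 0) \<phi> = 0"
  by (simp add: hankel_def op_series_def cscale_left_linear(3))

text \<open>
  A self-adjoint Toeplitz operator with non-constant symbol has no bound states, and every
  coefficient of an evolving vector vanishes in quadratic time average.  The proof uses no spectral theory.

  The symbol is split at frequency \<open>0\<close>.  The commutator of \<open>A = T\<^sub>c\<close> with the Toeplitz operator of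
  the positive frequencies is \<open>H\<^sup>* H\<close>, where \<open>H\<close> is the Hankel operator of the negative ones;
  so \<open>\<parallel>H \<phi>(s)\<parallel>\<^sup>2\<close> has a bounded integral, and the claim holds for \<open>v\<close> in the range of \<open>H\<^sup>*\<close>.  The
  vectors \<open>v\<close> for which it holds form a closed subspace \<open>V\<close> that \<open>A\<close> leaves invariant, because \<open>A\<close>
  commutes with the evolution.  A vector orthogonal to \<open>V\<close> lies in the space \<open>M\<close> on which all
  \<open>H A\<^sup>m\<close> vanish.  There \<open>A\<close> commutes with the right shift, so \<open>M = 0\<close> by the wandering-vector
  argument, and \<open>V\<close> is everything.
\<close>

theorem toep_null_average:
  assumes c: "l1 c" and herm: "\<And>m. c (- m) = cnj (c m)" and n: "n \<ge> 1" "c n \<noteq> 0"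
  shows "null_average (\<lambda>s. (v \<bullet> unitary_group (toep c) s \<phi>)\<^sup>2)"
proof -
  define A where "A = toep c"
  define H where "H = hankel (neg_tail c)"
  define H' where "H' = hankel (\<lambda>j. cnj (neg_tail c j))"
  define c' where "c' m = (if m \<ge> 1 then c m else 0)" for m
  have lc': "l1 c'"
    by (rule summable_on_comparison_test[OF c]) (auto simp: c'_def)
  have A: "bounded_clinear A" unfolding A_def by (rule bounded_clinear_toep[OF c])
  have sa: "adjoint_pair A A" using adjoint_toep[OF c] by (simp add: A_def herm)
  have H: "bounded_clinear H" unfolding H_def by (rule bounded_clinear_hankel[OF l1_neg_tail[OF c]])
  have adj: "H \<phi> \<bullet> \<psi> = \<phi> \<bullet> H' \<psi>" for \<phi> \<psi>
    using adjoint_hankel[OF l1_neg_tail[OF c]] by (simp add: adjoint_pair_def H_def H'_def)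
  have blA: "bounded_linear A" and blH: "bounded_linear H" using A H by (simp_all add: bounded_clinear_def)
  have Ac: "A (cscale z \<psi>) = cscale z (A \<psi>)" and Hc: "H (cscale z \<psi>) = cscale z (H \<psi>)" for z \<psi>
    using A H by (simp_all add: bounded_clinear_def)
  have comm: "\<psi> \<bullet> (A (toep c' \<psi>) - toep c' (A \<psi>)) = (norm (H \<psi>))\<^sup>2" for \<psi>
  proof -
    have "pos_tail c' = (\<lambda>j. cnj (neg_tail c j))"
      by (auto simp: pos_tail_def neg_tail_def c'_def herm[symmetric] add.commute)
    moreover have "neg_tail c' = (\<lambda>_. 0)" by (auto simp: neg_tail_def c'_def)
    moreover have "hankel (pos_tail c) 0 = 0"
      using bounded_clinear_hankel[OF l1_pos_tail[OF c]] linear_simps(3) by (auto simp: bounded_clinear_def)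
    ultimately have "A (toep c' \<psi>) - toep c' (A \<psi>) = H' (H \<psi>)"
      unfolding A_def toep_commutator[OF c lc'] by (simp add: H_def H'_def hankel_0)
    then show ?thesis by (simp add: adj[symmetric] power2_norm_eq_inner)
  qed
  let ?U = "unitary_group A"
  note contU = continuous_unitary_group[OF A sa]
  have cont: "continuous_on UNIV (\<lambda>s. (v \<bullet> ?U s \<phi>)\<^sup>2)" for v \<phi>
    by (intro continuous_intros contU)
  define V where "V = {v. \<forall>\<phi>. null_average (\<lambda>s. (v \<bullet> ?U s \<phi>)\<^sup>2)}"
  have sq: "(x + y)\<^sup>2 \<le> 2 * x\<^sup>2 + 2 * y\<^sup>2" for x y :: real
    using sum_squares_bound[of x y] by (simp add: power2_sum)
  have V1: "subspace V"
    unfolding subspace_def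
  proof (intro conjI ballI allI)
    show "0 \<in> V" by (simp add: V_def null_average_0)
    fix v w r assume v: "v \<in> V" "w \<in> V"
    have "null_average (\<lambda>s. ((v + w) \<bullet> ?U s \<phi>)\<^sup>2)" for \<phi>
    proof (rule null_average_dominated[OF cont])
      show "null_average (\<lambda>s. 2 * (v \<bullet> ?U s \<phi>)\<^sup>2 + 2 * (w \<bullet> ?U s \<phi>)\<^sup>2)"
        using v by (auto simp: V_def intro!: null_average_add null_average_cmult)
    qed (simp add: inner_add_left sq)
    then show "v + w \<in> V" by (simp add: V_def)
    have "null_average (\<lambda>s. r\<^sup>2 * (v \<bullet> ?U s \<phi>)\<^sup>2)" for \<phi>
      using v by (auto simp: V_def intro: null_average_cmult)
    then show "r *\<^sub>R v \<in> V" by (simp add: V_def power_mult_distrib)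
  qed
  have V2: "closed V"
    unfolding closed_sequential_limits
  proof (intro allI impI, elim conjE)
    fix x v assume x: "\<forall>n. x n \<in> V" "x \<longlonglongrightarrow> v"
    have "null_average (\<lambda>s. (v \<bullet> ?U s \<phi>)\<^sup>2)" for \<phi>
    proof (rule null_averageI[OF cont])
      fix e :: real assume "e > 0"
      have "(\<lambda>n. 2 * (norm (v - x n) * norm \<phi>)\<^sup>2) \<longlonglongrightarrow> 2 * (norm (v - v) * norm \<phi>)\<^sup>2"
        by (intro tendsto_intros x(2))
      then have "\<forall>\<^sub>F n in sequentially. 2 * (norm (v - x n) * norm \<phi>)\<^sup>2 < e"
        by (rule order_tendstoD) (use \<open>e > 0\<close> in simp)
      then obtain n where n: "2 * (norm (v - x n) * norm \<phi>)\<^sup>2 < e"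
        using eventually_happens trivial_limit_sequentially by blast
      show "\<exists>q'. null_average q' \<and> (\<forall>s. \<bar>(v \<bullet> ?U s \<phi>)\<^sup>2\<bar> \<le> q' s + e)"
      proof (intro exI conjI allI)
        show "null_average (\<lambda>s. 2 * (x n \<bullet> ?U s \<phi>)\<^sup>2)"
          using x(1) by (auto simp: V_def intro: null_average_cmult)
        fix s
        have "((v - x n) \<bullet> ?U s \<phi>)\<^sup>2 \<le> (norm (v - x n) * norm \<phi>)\<^sup>2"
          using power_mono[OF Cauchy_Schwarz_ineq2[of "v - x n" "?U s \<phi>"] abs_ge_zero, of 2]
          by (simp add: norm_unitary_group[OF A sa])
        then show "\<bar>(v \<bullet> ?U s \<phi>)\<^sup>2\<bar> \<le> 2 * (x n \<bullet> ?U s \<phi>)\<^sup>2 + e"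
          using sq[of "x n \<bullet> ?U s \<phi>" "(v - x n) \<bullet> ?U s \<phi>"] n by (simp add: inner_diff_left)
      qed
    qed
    then show "v \<in> V" by (simp add: V_def)
  qed
  have V3: "H' w \<in> V" for w
  proof -
    have "null_average (\<lambda>s. (H' w \<bullet> ?U s \<phi>)\<^sup>2)" for \<phi>
    proof (rule null_average_dominated[OF cont])
      obtain K where K: "\<And>t. t \<ge> 0 \<Longrightarrow> integral {0..t} (\<lambda>s. (norm (H (?U s \<phi>)))\<^sup>2) \<le> K"
        using commutator_smoothing[OF A sa bounded_clinear_toep[OF lc'] H comm, of \<phi>] by blast
      have "null_average (\<lambda>s. (norm (H (?U s \<phi>)))\<^sup>2)"
        by (rule null_average_bounded_integral[OF _ _ K])
          (auto intro!: continuous_intros bounded_linear.continuous_on[OF blH] contU)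
      then show "null_average (\<lambda>s. (norm w)\<^sup>2 * (norm (H (?U s \<phi>)))\<^sup>2)" by (rule null_average_cmult)
      fix s
      have "H' w \<bullet> ?U s \<phi> = w \<bullet> H (?U s \<phi>)" using adj[of "?U s \<phi>" w] by (simp add: inner_commute)
      then show "\<bar>(H' w \<bullet> ?U s \<phi>)\<^sup>2\<bar> \<le> (norm w)\<^sup>2 * (norm (H (?U s \<phi>)))\<^sup>2"
        using Cauchy_Schwarz_ineq[of w "H (?U s \<phi>)"] by (simp add: power2_norm_eq_inner)
    qed
    then show ?thesis by (simp add: V_def)
  qed
  have V4: "A v \<in> V" if "v \<in> V" for v
  proof -
    have "A v \<bullet> ?U s \<phi> = v \<bullet> ?U s (A \<phi>)" for s \<phi>
      using sa unitary_group_commute[OF A sa A] by (simp add: adjoint_pair_def)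
    then show ?thesis using that by (simp add: V_def)
  qed
  define M where "M = {u. \<forall>m. H ((A ^^ m) u) = 0}"
  have blHA: "bounded_linear (\<lambda>u. H ((A ^^ m) u))" for m
    using bounded_clinear_compose[OF H bounded_clinear_funpow[OF A]] by (simp add: bounded_clinear_def)
  have M0: "H \<psi> = 0" if "\<psi> \<in> M" for \<psi> 
  proof -
    have "H ((A ^^ 0) \<psi>) = 0" using that by (simp only: M_def mem_Collect_eq)
    then show ?thesis by simp
  qed
  have MA: "A \<psi> \<in> M" if "\<psi> \<in> M" for \<psi>
  proof -
    have "(A ^^ m) (A \<psi>) = (A ^^ Suc m) \<psi>" for m by (simp add: funpow_swap1)
    then show ?thesis using that by (simp only: M_def mem_Collect_eq) blast
  qed
  have MS: "A (shift 1 \<psi>) = shift 1 (A \<psi>)" if "\<psi> \<in> M" for \<psi>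
    using toep_shift_commute[OF c] M0[OF that] by (simp add: A_def H_def)
  have Mpow: "(A ^^ m) \<psi> \<in> M \<and> (A ^^ m) (shift 1 \<psi>) = shift 1 ((A ^^ m) \<psi>)" if "\<psi> \<in> M" for m \<psi>
    by (induction m) (simp_all add: that MA MS)
  have M: "\<psi> = 0" if "\<psi> \<in> M" for \<psi>
  proof (rule toep_invariant_subspace_trivial[OF c herm n _ _ _ _ _ _ that])
    show "subspace M"
      by (auto simp: M_def subspace_def linear_simps[OF blHA])
    have "closed {u. H ((A ^^ m) u) = 0}" for m
      by (rule closed_Collect_eq[OF linear_continuous_on[OF blHA] continuous_on_const])
    then show "closed M" unfolding M_def by (rule closed_Collect_all)
    show "cscale z \<psi> \<in> M" if "\<psi> \<in> M" for z \<psi>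
      using that bounded_clinear_compose[OF H bounded_clinear_funpow[OF A]] by (auto simp: M_def bounded_clinear_def cscale_linear)
    show "shift 1 \<psi> \<in> M" if "\<psi> \<in> M" for \<psi>
    proof -
      have "H ((A ^^ m) (shift 1 \<psi>)) = shift (-1) (H ((A ^^ m) \<psi>))" for m
        using Mpow[OF that] hankel_shift[OF l1_neg_tail[OF c]] by (simp add: H_def)
      then show ?thesis
        using that linear_simps(3)[of "shift (-1)"] bounded_clinear_shift[of "-1"] by (simp add: M_def bounded_clinear_def)
    qed
    show "toep c \<psi> \<in> M" if "\<psi> \<in> M" for \<psi> using MA[OF that] by (simp add: A_def)
    show "toep c (shift 1 \<psi>) = shift 1 (toep c \<psi>)" if "\<psi> \<in> M" for \<psi> using MS[OF that] by (simp add: A_def)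
  qed
  obtain p where p: "p \<in> V" "\<And>y. y \<in> V \<Longrightarrow> y \<bullet> (v - p) = 0"
    using closed_subspace_projection[OF V1 V2, of v] by blast
  have "v - p \<in> M"
    unfolding M_def
  proof (intro CollectI allI)
    fix m
    define w where "w = H ((A ^^ m) (v - p))"
    have "(A ^^ m) (H' w) \<in> V" by (induction m) (simp_all add: V3 V4)
    moreover have "(A ^^ m) x \<bullet> y = x \<bullet> (A ^^ m) y" for x y
      using sa by (induction m arbitrary: x y) (simp_all add: adjoint_pair_def funpow_swap1)
    ultimately have "H' w \<bullet> (A ^^ m) (v - p) = 0" using p(2)[of "(A ^^ m) (H' w)"] by simp
    then have "w \<bullet> w = 0" using adj[of "(A ^^ m) (v - p)" w] by (simp add: w_def inner_commute)
    then show "H ((A ^^ m) (v - p)) = 0" by (simp add: w_def)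
  qed
  then have "v = p" using M by force
  with p(1) show ?thesis by (simp add: V_def A_def)
qed

section \<open>Decay of products of Hankel operators\<close>

text \<open>
  The exponent has to exceed \<open>1/2\<close>, to make the weight square-summable, and to stay below \<open>1\<close>, to
  leave some decay for the sum over the intermediate index of a Hankel product.
\<close>

definition wt :: "nat \<Rightarrow> real" where
  "wt n = real (Suc n) powr (-3/4)"

definition wt_sum :: "ell2 \<Rightarrow> real" where
  "wt_sum \<psi> = (\<Sum>n. wt n * cmod (Rep_ell2 \<psi> n))"

lemma wt_pos: "wt n > 0" by (simp add: wt_def)

lemma summable_wt_sq: "summable (\<lambda>n. (wt n)\<^sup>2)"
proof -
  have "summable (\<lambda>n. real (Suc n) powr (-3/2))"
    using summable_Suc_iff[of "\<lambda>n. real n powr (-3/2)"] by (simp add: summable_real_powr_iff)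
  moreover have "(wt n)\<^sup>2 = real (Suc n) powr (-3/2)" for n
    by (simp add: wt_def power2_eq_square flip: powr_add)
  ultimately show ?thesis by simp
qed

lemma wt_summable: "summable (\<lambda>n. wt n * cmod (Rep_ell2 \<psi> n))"
proof (rule summable_comparison_test')
  show "summable (\<lambda>n. (wt n)\<^sup>2 + (cmod (Rep_ell2 \<psi> n))\<^sup>2)"
    by (intro summable_add summable_ell2 summable_wt_sq)
  show "norm (wt n * cmod (Rep_ell2 \<psi> n)) \<le> (wt n)\<^sup>2 + (cmod (Rep_ell2 \<psi> n))\<^sup>2" for n
    using sum_squares_bound[of "wt n" "cmod (Rep_ell2 \<psi> n)"] wt_pos[of n]
      mult_nonneg_nonneg[OF less_imp_le[OF wt_pos[of n]] norm_ge_zero[of "Rep_ell2 \<psi> n"]]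
    by (simp add: abs_mult del: mult_nonneg_nonneg)
qed

lemma powr_split:
  fixes x y w p q :: real
  assumes "0 < x" "x \<le> w" "0 < y" "y \<le> w" "p \<ge> 0" "q \<ge> 0"
  shows "w powr (- (p + q)) \<le> x powr (- p) * y powr (- q)"
proof -
  have "w powr (- (p + q)) = w powr (- p) * w powr (- q)" by (simp flip: powr_add)
  also have "\<dots> \<le> x powr (- p) * y powr (- q)"
    using assms by (intro mult_mono powr_mono2') auto
  finally show ?thesis .
qed

lemma hankel_decay:
  assumes q: "l1 q" "\<And>m. cmod (q m) \<le> K / (real (Suc m))\<^sup>2"
  shows "cmod (Rep_ell2 (hankel q \<psi>) j) \<le> K * real (Suc j) powr (-5/4) * wt_sum \<psi>"
proof -
  have "0 \<le> K" using q(2)[of 0] norm_ge_zero[of "q 0"] by (simp del: norm_ge_zero)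
  have bnd: "norm (q (j + k) * Rep_ell2 \<psi> k) \<le> K * real (Suc j) powr (-5/4) * (wt k * cmod (Rep_ell2 \<psi> k))" for k
  proof -
    have "cmod (q (j + k)) \<le> K * real (Suc (j + k)) powr (-2)"
      using q(2)[of "j + k"] by (simp add: powr_minus powr_realpow divide_inverse)
    also have "\<dots> \<le> K * (real (Suc j) powr (-5/4) * real (Suc k) powr (-3/4))"
      using powr_split[of "real (Suc j)" "real (Suc (j + k))" "real (Suc k)" "5/4" "3/4"] \<open>0 \<le> K\<close>
      by (intro mult_left_mono) auto
    finally have "cmod (q (j + k)) \<le> K * real (Suc j) powr (-5/4) * wt k"
      by (simp add: wt_def mult.assoc)
    from mult_right_mono[OF this norm_ge_zero[of "Rep_ell2 \<psi> k"]]
    show ?thesis by (simp add: norm_mult mult.assoc)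
  qed
  have sm: "summable (\<lambda>k. K * real (Suc j) powr (-5/4) * (wt k * cmod (Rep_ell2 \<psi> k)))"
    by (intro summable_mult wt_summable)
  have "(\<lambda>k. q (j + k) * Rep_ell2 \<psi> k) sums Rep_ell2 (hankel q \<psi>) j"
    by (rule has_sum_imp_sums[OF hankel_has_sum[OF q(1)]])
  then have "cmod (Rep_ell2 (hankel q \<psi>) j) = norm (\<Sum>k. q (j + k) * Rep_ell2 \<psi> k)"
    by (simp add: sums_iff)
  also have "\<dots> \<le> (\<Sum>k. K * real (Suc j) powr (-5/4) * (wt k * cmod (Rep_ell2 \<psi> k)))"
    by (rule norm_suminf_le[OF bnd sm])
  also have "\<dots> = K * real (Suc j) powr (-5/4) * wt_sum \<psi>"
    unfolding wt_sum_def by (rule suminf_mult[OF wt_summable])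
  finally show ?thesis .
qed

text \<open>
  One factor \<open>1 / (n + j + 1)\<close> of the first matrix absorbs the weight \<open>n + 1\<close>.  The other one and
  the entry of the second matrix are split between their two indices as \<open>3/4 + 1/4\<close> and
  \<open>5/4 + 3/4\<close>, so that the intermediate index \<open>j\<close> is left with the summable power \<open>-3/2\<close>.
\<close>

lemma hankel_product_decay:
  assumes p: "l1 p" "\<And>m. cmod (p m) \<le> K / (real (Suc m))\<^sup>2"
    and q: "l1 q" "\<And>m. cmod (q m) \<le> K / (real (Suc m))\<^sup>2"
  shows "real (Suc n) * cmod (Rep_ell2 (hankel p (hankel q \<psi>)) n)
    \<le> K\<^sup>2 * (\<Sum>j. real (Suc j) powr (-3/2)) * wt n * wt_sum \<psi>"
proof -
  have "0 \<le> K" using q(2)[of 0] norm_ge_zero[of "q 0"] by (simp del: norm_ge_zero)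
  let ?x = "\<lambda>j. Rep_ell2 (hankel q \<psi>) j"
  have bnd: "norm (p (n + j) * ?x j) \<le> K\<^sup>2 * wt n * wt_sum \<psi> / real (Suc n) * real (Suc j) powr (-3/2)" for j
  proof -
    have "1 / (real (Suc (n + j)))\<^sup>2 = real (Suc (n + j)) powr (-1) / real (Suc (n + j))"
      by (simp add: powr_minus power2_eq_square divide_inverse)
    also have "\<dots> \<le> (real (Suc n) powr (-3/4) * real (Suc j) powr (-1/4)) / real (Suc n)"
      using powr_split[of "real (Suc n)" "real (Suc (n + j))" "real (Suc j)" "3/4" "1/4"]
      by (intro frac_le) auto
    finally have "1 / (real (Suc (n + j)))\<^sup>2 \<le> wt n * real (Suc j) powr (-1/4) / real (Suc n)"
      by (simp add: wt_def)
    from mult_left_mono[OF this \<open>0 \<le> K\<close>]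
    have 1: "cmod (p (n + j)) \<le> K * (wt n * real (Suc j) powr (-1/4) / real (Suc n))"
      using p(2)[of "n + j"] by simp
    have "norm (p (n + j) * ?x j) \<le> (K * (wt n * real (Suc j) powr (-1/4) / real (Suc n)))
        * (K * real (Suc j) powr (-5/4) * wt_sum \<psi>)"
      unfolding norm_mult
      using 1 hankel_decay[OF q] \<open>0 \<le> K\<close> wt_pos[of n] by (intro mult_mono) auto
    also have "\<dots> = K\<^sup>2 * wt n * wt_sum \<psi> / real (Suc n) * (real (Suc j) powr (-1/4) * real (Suc j) powr (-5/4))"
      by (simp add: power2_eq_square)
    also have "real (Suc j) powr (-1/4) * real (Suc j) powr (-5/4) = real (Suc j) powr (-3/2)"
      by (simp flip: powr_add)
    finally show ?thesis .
  qed
  have s32: "summable (\<lambda>j. real (Suc j) powr (-3/2))"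
    using summable_Suc_iff[of "\<lambda>n. real n powr (-3/2)"] by (simp add: summable_real_powr_iff)
  have "(\<lambda>j. p (n + j) * ?x j) sums Rep_ell2 (hankel p (hankel q \<psi>)) n"
    by (rule has_sum_imp_sums[OF hankel_has_sum[OF p(1)]])
  then have "cmod (Rep_ell2 (hankel p (hankel q \<psi>)) n) = norm (\<Sum>j. p (n + j) * ?x j)"
    by (simp add: sums_iff)
  also have "\<dots> \<le> (\<Sum>j. K\<^sup>2 * wt n * wt_sum \<psi> / real (Suc n) * real (Suc j) powr (-3/2))"
    by (rule norm_suminf_le[OF bnd summable_mult[OF s32]])
  also have "\<dots> = K\<^sup>2 * wt n * wt_sum \<psi> / real (Suc n) * (\<Sum>j. real (Suc j) powr (-3/2))"
    by (rule suminf_mult[OF s32])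
  finally have "cmod (Rep_ell2 (hankel p (hankel q \<psi>)) n)
      \<le> K\<^sup>2 * wt n * wt_sum \<psi> / real (Suc n) * (\<Sum>j. real (Suc j) powr (-3/2))" .
  from mult_left_mono[OF this, of "real (Suc n)"] show ?thesis
    by (simp add: mult_ac)
qed

lemma hankel_product_form_bound:
  assumes p: "l1 p" "\<And>m. cmod (p m) \<le> K / (real (Suc m))\<^sup>2"
    and q: "l1 q" "\<And>m. cmod (q m) \<le> K / (real (Suc m))\<^sup>2"
    and \<eta>: "\<And>n. Rep_ell2 \<eta> n = of_nat (Suc n) * Rep_ell2 \<psi> n"
  shows "\<bar>\<eta> \<bullet> cscale \<i> (hankel p (hankel q \<psi>))\<bar> \<le> K\<^sup>2 * (\<Sum>j. real (Suc j) powr (-3/2)) * (wt_sum \<psi>)\<^sup>2"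
proof -
  let ?D = "K\<^sup>2 * (\<Sum>j. real (Suc j) powr (-3/2)) * wt_sum \<psi>"
  let ?y = "cscale \<i> (hankel p (hankel q \<psi>))"
  have "norm (Rep_ell2 \<eta> n \<bullet> Rep_ell2 ?y n) \<le> ?D * (wt n * cmod (Rep_ell2 \<psi> n))" for n
  proof -
    have "norm (Rep_ell2 \<eta> n \<bullet> Rep_ell2 ?y n) \<le> cmod (Rep_ell2 \<eta> n) * cmod (Rep_ell2 ?y n)"
      using Cauchy_Schwarz_ineq2 by simp
    also have "\<dots> = cmod (Rep_ell2 \<psi> n) * (real (Suc n) * cmod (Rep_ell2 (hankel p (hankel q \<psi>)) n))"
      by (simp add: \<eta> cscale.rep_eq norm_mult del: of_nat_Suc)
    also have "\<dots> \<le> cmod (Rep_ell2 \<psi> n) * (K\<^sup>2 * (\<Sum>j. real (Suc j) powr (-3/2)) * wt n * wt_sum \<psi>)"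
      by (intro mult_left_mono hankel_product_decay p q) auto
    finally show ?thesis by (simp add: mult_ac)
  qed
  then have "norm (\<Sum>n. Rep_ell2 \<eta> n \<bullet> Rep_ell2 ?y n) \<le> (\<Sum>n. ?D * (wt n * cmod (Rep_ell2 \<psi> n)))"
    by (rule norm_suminf_le[OF _ summable_mult[OF wt_summable]])
  also have "\<dots> = ?D * wt_sum \<psi>" unfolding wt_sum_def[of \<psi>] by (rule suminf_mult[OF wt_summable])
  finally show ?thesis by (simp add: inner_ell2_def power2_eq_square mult.assoc)
qed

text \<open>
  Finitely many coordinates control the weighted sum up to an error that is small uniformly on
  spheres.  The evolution stays on a sphere.
\<close>

lemma wt_sum_split:
  "(wt_sum \<psi>)\<^sup>2 \<le> 2 * (\<Sum>n. (wt n)\<^sup>2) * (\<Sum>n<N. (cmod (Rep_ell2 \<psi> n))\<^sup>2)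
    + 2 * (\<Sum>n. (wt (n + N))\<^sup>2) * (norm \<psi>)\<^sup>2"
proof -
  let ?u = "\<lambda>n. cmod (Rep_ell2 \<psi> n)"
  define x where "x = (\<Sum>n<N. wt n * ?u n)"
  define y where "y = (\<Sum>n. wt (n + N) * ?u (n + N))"
  have sN: "summable (\<lambda>n. (wt (n + N))\<^sup>2)" "summable (\<lambda>n. wt (n + N) * ?u (n + N))"
    "summable (\<lambda>n. (?u (n + N))\<^sup>2)"
    by (rule summable_ignore_initial_segment summable_wt_sq wt_summable summable_ell2)+
  have x2: "x\<^sup>2 \<le> (\<Sum>n. (wt n)\<^sup>2) * (\<Sum>n<N. (?u n)\<^sup>2)"
  proof -
    have "x\<^sup>2 \<le> (\<Sum>n<N. (wt n)\<^sup>2) * (\<Sum>n<N. (?u n)\<^sup>2)"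
      unfolding x_def by (rule Cauchy_Schwarz_ineq_sum)
    also have "\<dots> \<le> (\<Sum>n. (wt n)\<^sup>2) * (\<Sum>n<N. (?u n)\<^sup>2)"
      by (intro mult_right_mono sum_le_suminf summable_wt_sq sum_nonneg) auto
    finally show ?thesis .
  qed
  have y0: "y \<ge> 0" unfolding y_def by (intro suminf_nonneg sN) (simp add: wt_pos less_imp_le)
  let ?t = "\<Sum>n. (wt (n + N))\<^sup>2"
  have tail: "(\<Sum>n. (?u (n + N))\<^sup>2) \<le> (norm \<psi>)\<^sup>2"
    using suminf_split_initial_segment[OF summable_ell2[of \<psi>], of N]
      sum_nonneg[of "{..<N}" "\<lambda>n. (?u n)\<^sup>2"] by (simp add: norm_ell2_sq)
  have "y \<le> sqrt (?t * (norm \<psi>)\<^sup>2)"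
    unfolding y_def
  proof (rule suminf_le_const[OF sN(2)])
    fix M
    have "(\<Sum>n<M. wt (n + N) * ?u (n + N))\<^sup>2 \<le> (\<Sum>n<M. (wt (n + N))\<^sup>2) * (\<Sum>n<M. (?u (n + N))\<^sup>2)"
      by (rule Cauchy_Schwarz_ineq_sum)
    also have "\<dots> \<le> ?t * (norm \<psi>)\<^sup>2"
    proof (rule mult_mono)
      show "(\<Sum>n<M. (wt (n + N))\<^sup>2) \<le> ?t" by (rule sum_le_suminf[OF sN(1)]) auto
      have "(\<Sum>n<M. (?u (n + N))\<^sup>2) \<le> (\<Sum>n. (?u (n + N))\<^sup>2)" by (rule sum_le_suminf[OF sN(3)]) auto
      then show "(\<Sum>n<M. (?u (n + N))\<^sup>2) \<le> (norm \<psi>)\<^sup>2" using tail by linarith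
    qed (auto intro: suminf_nonneg sN sum_nonneg)
    finally show "(\<Sum>n<M. wt (n + N) * ?u (n + N)) \<le> sqrt (?t * (norm \<psi>)\<^sup>2)"
      by (rule real_le_rsqrt)
  qed
  then have "y\<^sup>2 \<le> (sqrt (?t * (norm \<psi>)\<^sup>2))\<^sup>2" using y0 by (rule power_mono)
  also have "\<dots> = ?t * (norm \<psi>)\<^sup>2"
    by (intro real_sqrt_pow2 mult_nonneg_nonneg suminf_nonneg sN) auto
  finally have y2: "y\<^sup>2 \<le> ?t * (norm \<psi>)\<^sup>2" .
  have "wt_sum \<psi> = x + y"
    unfolding wt_sum_def x_def y_def using suminf_split_initial_segment[OF wt_summable, of \<psi> N] by simp
  then have "(wt_sum \<psi>)\<^sup>2 \<le> 2 * x\<^sup>2 + 2 * y\<^sup>2"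
    using sum_squares_bound[of x y] by (simp add: power2_sum)
  with x2 y2 show ?thesis by (simp add: mult.assoc)
qed

section \<open>Growth of the position\<close>

lemma l1_decay:
  fixes a :: "int \<Rightarrow> complex"
  assumes "\<And>m. m \<noteq> 0 \<Longrightarrow> cmod (a m) \<le> K / (real_of_int m)\<^sup>2"
  shows "l1 a"
proof -
  have s: "summable (\<lambda>k. K / (real (Suc k))\<^sup>2)"
    using summable_mult[OF summable_Suc_iff[THEN iffD2, OF inverse_power_summable[of 2]], of K]
    by (simp add: divide_inverse)
  have half: "(\<lambda>k. cmod (a (g k))) summable_on UNIV"
    if "\<And>k. \<bar>g k\<bar> = int (Suc k)" for g :: "nat \<Rightarrow> int"
  proof (rule summable_nonneg_imp_summable_on[OF summable_comparison_test'[OF s]])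
    fix k
    have "(real_of_int (g k))\<^sup>2 = (real (Suc k))\<^sup>2"
      using that[of k] by (metis of_int_abs of_int_of_nat_eq power2_abs)
    moreover have "g k \<noteq> 0" using that[of k] by auto
    ultimately show "norm (cmod (a (g k))) \<le> K / (real (Suc k))\<^sup>2" using assms[of "g k"] by simp
  qed simp
  have r: "(\<lambda>m. cmod (a m)) summable_on range g"
    if "\<And>k. \<bar>g k\<bar> = int (Suc k)" "inj g" for g :: "nat \<Rightarrow> int"
    using half[OF that(1)] summable_on_reindex[OF that(2), of "\<lambda>m. cmod (a m)"] by (simp add: comp_def)
  have 1: "(\<lambda>m. cmod (a m)) summable_on range (\<lambda>k. int (Suc k))"
    by (rule r) (auto simp: inj_on_def)
  have 2: "(\<lambda>m. cmod (a m)) summable_on range (\<lambda>k. - int (Suc k))"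
    by (rule r) (auto simp: inj_on_def)
  have "(\<lambda>m. cmod (a m)) summable_on ({0} \<union> range (\<lambda>k. int (Suc k))) \<union> range (\<lambda>k. - int (Suc k))"
    by (intro summable_on_union 1 2) simp
  moreover have "({0} \<union> range (\<lambda>k. int (Suc k))) \<union> range (\<lambda>k. - int (Suc k)) = UNIV"
  proof -
    have "m \<in> ({0} \<union> range (\<lambda>k. int (Suc k))) \<union> range (\<lambda>k. - int (Suc k))" for m
      by (cases m rule: int_cases3) (auto simp: image_iff gr0_conv_Suc)
    then show ?thesis by blast
  qed
  ultimately show ?thesis by simp
qed

definition deriv_coeff :: "(int \<Rightarrow> complex) \<Rightarrow> int \<Rightarrow> complex" where
  "deriv_coeff c m = \<i> * of_int m * c m"

text \<open>
  These conditions hold for the Fourier coefficients of a real function of class \<open>C\<^sup>3\<close>.  They are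
  stable under negation, which exchanges the two directions of time.
\<close>

locale smooth_symbol =
  fixes c :: "int \<Rightarrow> complex" and K :: real
  assumes herm: "c (- m) = cnj (c m)"
    and decay: "m \<noteq> 0 \<Longrightarrow> cmod (c m) \<le> K / \<bar>real_of_int m\<bar> ^ 3"
begin

abbreviation "A \<equiv> toep c"
abbreviation "B \<equiv> toep (deriv_coeff c)"
abbreviation "U \<equiv> unitary_group A"

lemma K_nonneg: "K \<ge> 0"
  using decay[of 1] norm_ge_zero[of "c 1"] by (simp del: norm_ge_zero)

lemma decay_coeffs:
  assumes "m \<noteq> 0"
  shows "cmod (c m) \<le> K / (real_of_int m)\<^sup>2" "cmod (deriv_coeff c m) \<le> K / (real_of_int m)\<^sup>2"
proof -
  have m: "\<bar>real_of_int m\<bar> \<ge> 1" using assms by linarith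
  have e: "\<bar>real_of_int m\<bar> ^ 3 = \<bar>real_of_int m\<bar> * (real_of_int m)\<^sup>2"
    by (simp add: power3_eq_cube power2_eq_square)
  have "K / \<bar>real_of_int m\<bar> ^ 3 \<le> K / (real_of_int m)\<^sup>2"
    using m K_nonneg assms by (intro divide_left_mono) (auto simp: e mult_le_cancel_right1)
  then show "cmod (c m) \<le> K / (real_of_int m)\<^sup>2" using decay[OF assms] by linarith
  have "cmod (deriv_coeff c m) = \<bar>real_of_int m\<bar> * cmod (c m)"
    by (simp add: deriv_coeff_def norm_mult)
  also have "\<dots> \<le> \<bar>real_of_int m\<bar> * (K / \<bar>real_of_int m\<bar> ^ 3)"
    by (intro mult_left_mono decay assms) simp
  also have "\<dots> = K / (real_of_int m)\<^sup>2" unfolding e using m by simp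
  finally show "cmod (deriv_coeff c m) \<le> K / (real_of_int m)\<^sup>2" .
qed

lemma l1c: "l1 c" and l1b: "l1 (deriv_coeff c)"
  by (rule l1_decay, erule decay_coeffs)+

lemma bounded_clinear_A: "bounded_clinear A" and bounded_clinear_B: "bounded_clinear B"
  by (intro bounded_clinear_toep l1c l1b)+

lemma selfadj_A: "adjoint_pair A A"
  using adjoint_toep[OF l1c] by (simp add: herm)

lemma tail_decay:
  assumes "\<And>m. m \<noteq> 0 \<Longrightarrow> cmod (a m) \<le> K / (real_of_int m)\<^sup>2"
  shows "cmod (pos_tail a j) \<le> K / (real (Suc j))\<^sup>2" "cmod (neg_tail a j) \<le> K / (real (Suc j))\<^sup>2"
proof -
  have "(real_of_int (- int j - 1))\<^sup>2 = (real (Suc j))\<^sup>2" by (simp add: power2_eq_square algebra_simps)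
  then show "cmod (neg_tail a j) \<le> K / (real (Suc j))\<^sup>2"
    using assms[of "- int j - 1"] by (simp add: neg_tail_def)
  show "cmod (pos_tail a j) \<le> K / (real (Suc j))\<^sup>2"
    using assms[of "int j + 1"] by (simp add: pos_tail_def add.commute)
qed

text \<open>
  The operator \<open>i[B,A]\<close>, which drives the correction to the acceleration of the squared position.
\<close>

definition commutator :: "ell2 \<Rightarrow> ell2" where
  "commutator \<psi> = cscale \<i> (B (A \<psi>) - A (B \<psi>))"

lemma commutator_form_bound:
  obtains D where "D \<ge> 0"
    "\<And>\<eta> \<psi>. (\<And>n. Rep_ell2 \<eta> n = of_nat (Suc n) * Rep_ell2 \<psi> n) \<Longrightarrow>
      \<bar>\<eta> \<bullet> commutator \<psi>\<bar> \<le> D * (wt_sum \<psi>)\<^sup>2"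
proof -
  define D where "D = K\<^sup>2 * (\<Sum>j. real (Suc j) powr (-3/2))"
  have "summable (\<lambda>j. real (Suc j) powr (-3/2))"
    using summable_Suc_iff[of "\<lambda>n. real n powr (-3/2)"] by (simp add: summable_real_powr_iff)
  then have D0: "D \<ge> 0" unfolding D_def by (intro mult_nonneg_nonneg suminf_nonneg) auto
  note c = decay_coeffs(1) and b = decay_coeffs(2)
  have bound: "\<bar>\<eta> \<bullet> commutator \<psi>\<bar> \<le> 2 * D * (wt_sum \<psi>)\<^sup>2"
    if "\<And>n. Rep_ell2 \<eta> n = of_nat (Suc n) * Rep_ell2 \<psi> n" for \<eta> \<psi>
  proof -
    let ?x = "hankel (pos_tail c) (hankel (neg_tail (deriv_coeff c)) \<psi>)"
    let ?y = "hankel (pos_tail (deriv_coeff c)) (hankel (neg_tail c) \<psi>)"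
    have "\<eta> \<bullet> commutator \<psi> = \<eta> \<bullet> cscale \<i> ?x - \<eta> \<bullet> cscale \<i> ?y"
      unfolding commutator_def toep_commutator[OF l1b l1c] by (simp add: cscale_linear inner_diff_right)
    moreover have "\<bar>\<eta> \<bullet> cscale \<i> ?x\<bar> \<le> D * (wt_sum \<psi>)\<^sup>2"
      unfolding D_def
      by (rule hankel_product_form_bound[OF l1_pos_tail[OF l1c] tail_decay(1)[OF c]
            l1_neg_tail[OF l1b] tail_decay(2)[OF b] that])
    moreover have "\<bar>\<eta> \<bullet> cscale \<i> ?y\<bar> \<le> D * (wt_sum \<psi>)\<^sup>2"
      unfolding D_def
      by (rule hankel_product_form_bound[OF l1_pos_tail[OF l1b] tail_decay(1)[OF b]
            l1_neg_tail[OF l1c] tail_decay(2)[OF c] that])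
    ultimately show ?thesis by linarith
  qed
  show ?thesis by (rule that[of "2 * D"]) (use D0 bound in auto)
qed

lemma null_average_coords:
  assumes "n \<ge> 1" "c n \<noteq> 0"
  shows "null_average (\<lambda>s. (cmod (Rep_ell2 (U s \<phi>) k))\<^sup>2)"
proof -
  have "(cmod (Rep_ell2 \<psi> k))\<^sup>2 = (basis k \<bullet> \<psi>)\<^sup>2 + (cscale \<i> (basis k) \<bullet> \<psi>)\<^sup>2" for \<psi>
    using inner_basis[of 1 k \<psi>] inner_basis[of \<i> k \<psi>]
    by (simp add: inner_complex_def cmod_power2)
  then show ?thesis
    using null_average_add[OF toep_null_average[OF l1c herm assms] toep_null_average[OF l1c herm assms]] by simp
qed

text \<open>
  By the decay of the Hankel products the correction is bounded by the weighted sum of the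
  moduli of the coordinates, each of which vanishes in quadratic time average.  If all coefficients off the diagonal are
  zero, then \<open>B = 0\<close> and there is no correction.
\<close>

lemma null_average_commutator:
  assumes Y: "continuous_on UNIV Y" "\<And>s n. Rep_ell2 (Y s) n = of_nat (Suc n) * Rep_ell2 (U s \<phi>) n"
  shows "null_average (\<lambda>s. Y s \<bullet> commutator (U s \<phi>))"
proof -
  have "bounded_clinear commutator"
    unfolding commutator_def [abs_def]
    by (rule bounded_clinear_cscale[OF bounded_clinear_diff[OF bounded_clinear_compose[OF bounded_clinear_B bounded_clinear_A] bounded_clinear_compose[OF bounded_clinear_A bounded_clinear_B]]])
  then have bl: "bounded_linear commutator" by (simp add: bounded_clinear_def)
  have cont: "continuous_on UNIV (\<lambda>s. Y s \<bullet> commutator (U s \<phi>))"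
    by (intro continuous_intros Y(1) bounded_linear.continuous_on[OF bl] continuous_unitary_group[OF bounded_clinear_A selfadj_A])
  show ?thesis
  proof (cases "\<exists>n\<ge>1. c n \<noteq> 0")
    case True
    then obtain m where m: "m \<ge> 1" "c m \<noteq> 0" by blast
    obtain D where D: "D \<ge> 0" "\<And>\<eta> \<psi>. (\<And>n. Rep_ell2 \<eta> n = of_nat (Suc n) * Rep_ell2 \<psi> n) \<Longrightarrow>
      \<bar>\<eta> \<bullet> commutator \<psi>\<bar> \<le> D * (wt_sum \<psi>)\<^sup>2"
      using commutator_form_bound by blast
    let ?a = "\<Sum>n. (wt n)\<^sup>2"
    show ?thesis
    proof (rule null_averageI[OF cont])
      fix e :: real assume "e > 0"
      have "(\<lambda>N. D * (2 * (\<Sum>n. (wt (n + N))\<^sup>2) * (norm \<phi>)\<^sup>2)) \<longlonglongrightarrow> D * (2 * 0 * (norm \<phi>)\<^sup>2)"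
        by (intro tendsto_intros suminf_exist_split2 summable_wt_sq)
      then have "\<forall>\<^sub>F N in sequentially. D * (2 * (\<Sum>n. (wt (n + N))\<^sup>2) * (norm \<phi>)\<^sup>2) < e"
        by (rule order_tendstoD) (use \<open>e > 0\<close> in simp)
      then obtain N where N: "D * (2 * (\<Sum>n. (wt (n + N))\<^sup>2) * (norm \<phi>)\<^sup>2) < e"
        using eventually_happens trivial_limit_sequentially by blast
      let ?q = "\<lambda>s. (D * (2 * ?a)) * (\<Sum>n<N. (cmod (Rep_ell2 (U s \<phi>) n))\<^sup>2)"
      show "\<exists>q'. null_average q' \<and> (\<forall>s. \<bar>Y s \<bullet> commutator (U s \<phi>)\<bar> \<le> q' s + e)"
      proof (intro exI conjI allI)
        show "null_average ?q" by (intro null_average_cmult null_average_sum null_average_coords[OF m])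
        fix s
        have "\<bar>Y s \<bullet> commutator (U s \<phi>)\<bar> \<le> D * (wt_sum (U s \<phi>))\<^sup>2" by (rule D(2)[OF Y(2)])
        also have "\<dots> \<le> D * (2 * ?a * (\<Sum>n<N. (cmod (Rep_ell2 (U s \<phi>) n))\<^sup>2)
            + 2 * (\<Sum>n. (wt (n + N))\<^sup>2) * (norm \<phi>)\<^sup>2)"
          using wt_sum_split[of "U s \<phi>" N] D(1) norm_unitary_group[OF bounded_clinear_A selfadj_A]
          by (intro mult_left_mono) auto
        also have "\<dots> \<le> ?q s + e" using N by (simp add: distrib_left mult.assoc)
        finally show "\<bar>Y s \<bullet> commutator (U s \<phi>)\<bar> \<le> ?q s + e" .
      qed
    qed
  next
    case False
    have "deriv_coeff c m = 0" for m
    proof -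
      consider "m \<ge> 1" | "m = 0" | "- m \<ge> 1" by linarith
      then show ?thesis
      proof cases
        case 3
        then have "c (- m) = 0" using False by blast
        then have "c m = 0" using herm[of m] by simp
        then show ?thesis by (simp add: deriv_coeff_def)
      qed (use False in \<open>auto simp: deriv_coeff_def\<close>)
    qed
    then have "B \<psi> = 0" for \<psi>
      by (simp add: toep_def op_series_def cscale_left_linear(3))
    then have "commutator \<psi> = 0" for \<psi>
      using bounded_clinear_A linear_simps(3)[of A] by (simp add: commutator_def bounded_clinear_def cscale_linear)
    then show ?thesis by (simp add: null_average_0)
  qed
qed

subsection \<open>The evolution in the graph of the position operator\<close>

text \<open>
  The pair of \<open>\<psi> = \<phi>(t)\<close> and \<open>\<eta> = X \<phi>(t)\<close> obeys a linear equation with a bounded generator, as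
  \<open>X A - A X = -i B\<close>.  So no domain question arises for the derivative of \<open>X \<phi>(t)\<close>.
\<close>

definition generator :: "ell2 \<times> ell2 \<Rightarrow> ell2 \<times> ell2" where
  "generator = (\<lambda>(\<psi>, \<eta>). (cscale \<i> (A \<psi>), cscale \<i> (A \<eta>) + B \<psi>))"

definition graph_X :: "(ell2 \<times> ell2) set" where
  "graph_X = {(\<psi>, \<eta>). \<forall>n. Rep_ell2 \<eta> n = of_nat (Suc n) * Rep_ell2 \<psi> n}"

lemma graph_X_pos:
  assumes "(\<psi>, \<eta>) \<in> graph_X"
  shows "\<eta> = pos_X \<psi>"
proof -
  have e: "Rep_ell2 \<eta> = (\<lambda>n. of_nat (Suc n) * Rep_ell2 \<psi> n)"
    using assms by (auto simp: graph_X_def)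
  show ?thesis unfolding pos_X_def e[symmetric] by (simp add: Rep_ell2_inverse)
qed

lemma bounded_linear_generator: "bounded_linear generator"
proof -
  have bl: "bounded_linear (\<lambda>\<psi>. cscale \<i> (A \<psi>))" "bounded_linear B"
    using bounded_clinear_cscale[OF bounded_clinear_A] bounded_clinear_B by (simp_all add: bounded_clinear_def)
  show ?thesis
    unfolding generator_def case_prod_beta'
    by (intro bounded_linear_Pair bounded_linear_add bounded_linear_compose[OF bl(1)]
        bounded_linear_compose[OF bl(2)] bounded_linear_fst bounded_linear_snd)
qed

lemma graph_X_invariant:
  assumes "x \<in> graph_X"
  shows "generator x \<in> graph_X"
proof -
  obtain \<psi> \<eta> where x: "x = (\<psi>, \<eta>)" by (cases x)
  with assms have \<eta>: "Rep_ell2 \<eta> n = of_nat (Suc n) * Rep_ell2 \<psi> n" for n by (simp add: graph_X_def)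
  have "Rep_ell2 (cscale \<i> (A \<eta>) + B \<psi>) n = of_nat (Suc n) * Rep_ell2 (cscale \<i> (A \<psi>)) n" for n
  proof (rule has_sum_unique)
    have "((\<lambda>k. \<i> * (c (int n - int k) * Rep_ell2 \<eta> k) + deriv_coeff c (int n - int k) * Rep_ell2 \<psi> k)
        has_sum \<i> * Rep_ell2 (A \<eta>) n + Rep_ell2 (B \<psi>) n) UNIV"
      by (intro has_sum_add has_sum_cmult_right toep_has_sum l1c l1b)
    then show "((\<lambda>k. \<i> * (c (int n - int k) * Rep_ell2 \<eta> k) + deriv_coeff c (int n - int k) * Rep_ell2 \<psi> k)
        has_sum Rep_ell2 (cscale \<i> (A \<eta>) + B \<psi>) n) UNIV"
      by (simp add: plus_ell2.rep_eq cscale.rep_eq)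
    have "((\<lambda>k. of_nat (Suc n) * (\<i> * (c (int n - int k) * Rep_ell2 \<psi> k)))
        has_sum of_nat (Suc n) * (\<i> * Rep_ell2 (A \<psi>) n)) UNIV"
      by (intro has_sum_cmult_right toep_has_sum l1c)
    moreover have "of_nat (Suc n) * (\<i> * (c (int n - int k) * Rep_ell2 \<psi> k))
      = \<i> * (c (int n - int k) * Rep_ell2 \<eta> k) + deriv_coeff c (int n - int k) * Rep_ell2 \<psi> k" for k
      unfolding \<eta> deriv_coeff_def by (simp add: algebra_simps)
    ultimately show "((\<lambda>k. \<i> * (c (int n - int k) * Rep_ell2 \<eta> k) + deriv_coeff c (int n - int k) * Rep_ell2 \<psi> k)
        has_sum of_nat (Suc n) * Rep_ell2 (cscale \<i> (A \<psi>)) n) UNIV"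
      by (simp add: cscale.rep_eq del: of_nat_Suc)
  qed
  then show ?thesis by (simp add: x generator_def graph_X_def)
qed

lemma graph_X_closed: "closed graph_X"
proof -
  have "closed {x. Rep_ell2 (snd x) n = of_nat (Suc n) * Rep_ell2 (fst x) n}" for n
    by (intro closed_Collect_eq continuous_intros bounded_linear.continuous_on[OF bounded_linear_coord])
  then have "closed {x. \<forall>n. Rep_ell2 (snd x) n = of_nat (Suc n) * Rep_ell2 (fst x) n}"
    by (rule closed_Collect_all)
  then show ?thesis by (simp add: graph_X_def case_prod_beta')
qed

lemma graph_X_subspace: "subspace graph_X"
  by (auto simp: subspace_def graph_X_def zero_prod_def zero_ell2.rep_eq plus_ell2.rep_eq
      scaleR_ell2.rep_eq distrib_left simp del: of_nat_Suc)

lemma position_derivative: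
  assumes "\<phi> \<in> dom_X"
  obtains Y where "\<And>t. Y t = pos_X (U t \<phi>)"
    "\<And>t n. Rep_ell2 (Y t) n = of_nat (Suc n) * Rep_ell2 (U t \<phi>) n"
    "\<And>t. (Y has_vector_derivative cscale \<i> (A (Y t)) + B (U t \<phi>)) (at t)"
proof -
  let ?x = "(\<phi>, pos_X \<phi>)"
  define Y where "Y t = snd (exp_curve generator t ?x)" for t
  have "fst (exp_curve generator t ?x) = U t (fst ?x)" for t
    by (rule exp_curve_intertwine[OF bounded_linear_fst bounded_linear_generator])
      (simp add: generator_def case_prod_beta')
  then have e: "exp_curve generator t ?x = (U t \<phi>, Y t)" for t by (simp add: Y_def prod_eq_iff)
  have x: "?x \<in> graph_X" using Rep_pos_X[OF assms] by (simp add: graph_X_def)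
  have g: "(U t \<phi>, Y t) \<in> graph_X" for t
    unfolding e[symmetric]
    by (rule exp_curve_closed[OF graph_X_subspace graph_X_closed bounded_linear_generator graph_X_invariant x])
  show ?thesis
  proof (rule that)
    show "Y t = pos_X (U t \<phi>)" for t by (rule graph_X_pos[OF g])
    show "Rep_ell2 (Y t) n = of_nat (Suc n) * Rep_ell2 (U t \<phi>) n" for t n
      using g by (simp add: graph_X_def)
    have "(Y has_vector_derivative snd (generator (exp_curve generator t ?x))) (at t)" for t
      unfolding Y_def [abs_def]
      by (rule bounded_linear.has_vector_derivative[OF bounded_linear_snd exp_curve_derivative[OF bounded_linear_generator]])
    then show "(Y has_vector_derivative cscale \<i> (A (Y t)) + B (U t \<phi>)) (at t)" for t
      unfolding e by (simp add: generator_def)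
  qed
qed

text \<open>
  Here \<open>h\<close> is \<open>\<eta> \<bullet> B \<phi>\<close>.  In both derivatives the contribution of \<open>i A\<close> cancels or combines
  into a commutator, because \<open>i A\<close> is skew-adjoint.
\<close>

theorem position_growth:
  assumes "\<phi> \<in> dom_X"
  obtains h q where
    "\<And>t. ((\<lambda>t. (norm (pos_X (U t \<phi>)))\<^sup>2) has_real_derivative 2 * h t) (at t)"
    "\<And>t. (h has_real_derivative (norm (B (U t \<phi>)))\<^sup>2 + q t) (at t)"
    "null_average q"
proof -
  obtain Y where Y: "\<And>t. Y t = pos_X (U t \<phi>)"
    "\<And>t n. Rep_ell2 (Y t) n = of_nat (Suc n) * Rep_ell2 (U t \<phi>) n"
    "\<And>t. (Y has_vector_derivative cscale \<i> (A (Y t)) + B (U t \<phi>)) (at t)"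
    using position_derivative[OF assms] by blast
  note dU = unitary_group_derivative[OF bounded_clinear_A selfadj_A]
  have blB: "bounded_linear B" using bounded_clinear_B by (simp add: bounded_clinear_def)
  show ?thesis
  proof (rule that)
    fix t
    have "((\<lambda>t. Y t \<bullet> Y t) has_vector_derivative
        Y t \<bullet> (cscale \<i> (A (Y t)) + B (U t \<phi>)) + (cscale \<i> (A (Y t)) + B (U t \<phi>)) \<bullet> Y t) (at t)"
      by (rule bounded_bilinear.has_vector_derivative[OF bounded_bilinear_inner Y(3) Y(3)])
    also have "Y t \<bullet> (cscale \<i> (A (Y t)) + B (U t \<phi>)) + (cscale \<i> (A (Y t)) + B (U t \<phi>)) \<bullet> Y t
        = 2 * (Y t \<bullet> B (U t \<phi>))"
      using iA_self[OF bounded_clinear_A selfadj_A, of "Y t"] by (simp add: inner_add inner_commute)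
    finally show "((\<lambda>t. (norm (pos_X (U t \<phi>)))\<^sup>2) has_real_derivative 2 * (Y t \<bullet> B (U t \<phi>))) (at t)"
      by (simp add: has_real_derivative_iff_has_vector_derivative power2_norm_eq_inner Y(1))
  next
    fix t
    have "((\<lambda>t. Y t \<bullet> B (U t \<phi>)) has_vector_derivative
        Y t \<bullet> B (cscale \<i> (A (U t \<phi>))) + (cscale \<i> (A (Y t)) + B (U t \<phi>)) \<bullet> B (U t \<phi>)) (at t)"
      by (rule bounded_bilinear.has_vector_derivative[OF bounded_bilinear_inner Y(3)
            bounded_linear.has_vector_derivative[OF blB dU]])
    also have "Y t \<bullet> B (cscale \<i> (A (U t \<phi>))) + (cscale \<i> (A (Y t)) + B (U t \<phi>)) \<bullet> B (U t \<phi>)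
        = (norm (B (U t \<phi>)))\<^sup>2 + Y t \<bullet> commutator (U t \<phi>)"
    proof -
      have "cscale (- \<i>) x = - cscale \<i> x" for x using cscale_left_linear(4)[of \<i>] by simp
      moreover have "B (cscale \<i> x) = cscale \<i> (B x)" for x using bounded_clinear_B by (simp add: bounded_clinear_def)
      ultimately show ?thesis
        by (simp add: commutator_def inner_add_left iA_skew[OF bounded_clinear_A selfadj_A] power2_norm_eq_inner
            cscale_linear inner_diff_right)
    qed
    finally show "((\<lambda>t. Y t \<bullet> B (U t \<phi>)) has_real_derivative
        (norm (B (U t \<phi>)))\<^sup>2 + Y t \<bullet> commutator (U t \<phi>)) (at t)"
      by (simp add: has_real_derivative_iff_has_vector_derivative)
  next
    have "continuous_on UNIV Y"
      by (rule continuous_at_imp_continuous_on) (use Y(3) has_vector_derivative_continuous in blast)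
    then show "null_average (\<lambda>t. Y t \<bullet> commutator (U t \<phi>))"
      by (rule null_average_commutator[OF _ Y(2)])
  qed
qed

end

section \<open>From the second derivative to ballistic growth rates\<close>

text \<open>
  The first integration turns the average of \<open>p\<close> into linear growth of \<open>h\<close>, the second one turns
  this into quadratic growth of \<open>g\<close>.  Half of the gap between \<open>a\<close> and \<open>b\<close> is spent on each.
\<close>

lemma quadratic_lower_bound:
  fixes g h p q :: "real \<Rightarrow> real"
  assumes dg: "\<And>t. (g has_real_derivative 2 * h t) (at t)"
    and dh: "\<And>t. (h has_real_derivative p t + q t) (at t)"
    and p: "continuous_on UNIV p" and q: "null_average q"
    and ev: "\<forall>\<^sub>F t in at_top. a < integral {0..t} p / t" and ba: "b < a"
  shows "\<forall>\<^sub>F t in at_top. b < g t / t\<^sup>2"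
proof -
  define \<delta> where "\<delta> = (a - b) / 2"
  have \<delta>: "\<delta> > 0" using ba by (simp add: \<delta>_def)
  have qc: "continuous_on UNIV q" using q by (simp add: null_average_def)
  have h: "h t = h 0 + integral {0..t} p + integral {0..t} q" if "t \<ge> 0" for t
  proof -
    have "((\<lambda>s. p s + q s) has_integral h t - h 0) {0..t}"
      by (rule fundamental_theorem_of_calculus[OF that])
        (use dh in \<open>auto simp: has_real_derivative_iff_has_vector_derivative intro: has_vector_derivative_at_within\<close>)
    then have "integral {0..t} (\<lambda>s. p s + q s) = h t - h 0" by (rule integral_unique)
    then show ?thesis by (simp add: integral_add continuous_integrable p qc)
  qed
  have inv: "((\<lambda>t. r / t) \<longlongrightarrow> 0) at_top" for r :: real
    by (rule tendsto_divide_0[OF tendsto_const filterlim_at_top_imp_at_infinity[OF filterlim_ident]])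
  have "((\<lambda>t. h 0 / t + integral {0..t} q / t) \<longlongrightarrow> 0 + 0) at_top"
    using q by (intro tendsto_add inv) (simp add: null_average_def)
  then have "\<forall>\<^sub>F t in at_top. - \<delta> < h 0 / t + integral {0..t} q / t"
    by (rule order_tendstoD) (use \<delta> in simp)
  with ev eventually_gt_at_top[of 0] have "\<forall>\<^sub>F t in at_top. (a - \<delta>) * t < h t"
  proof eventually_elim
    case (elim t)
    have "h t / t = h 0 / t + integral {0..t} p / t + integral {0..t} q / t"
      using h[of t] elim(2) by (simp add: add_divide_distrib)
    with elim have "a - \<delta> < h t / t" by linarith
    then show ?case using elim(2) by (simp add: pos_less_divide_eq)
  qed
  then obtain N where N: "\<And>t. t \<ge> N \<Longrightarrow> (a - \<delta>) * t < h t"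
    by (auto simp: eventually_at_top_linorder)
  define t0 where "t0 = max N 1"
  define G where "G t = g t - (a - \<delta>) * t\<^sup>2" for t
  have G: "G t0 \<le> G t" if "t0 \<le> t" for t
  proof (rule DERIV_nonneg_imp_nondecreasing[OF that])
    fix x assume x: "t0 \<le> x" "x \<le> t"
    have "(G has_real_derivative 2 * h x - (a - \<delta>) * (2 * x)) (at x)"
      unfolding G_def [abs_def] by (auto intro!: derivative_eq_intros dg)
    moreover have "0 \<le> 2 * h x - (a - \<delta>) * (2 * x)" using N[of x] x by (simp add: t0_def)
    ultimately show "\<exists>y. (G has_real_derivative y) (at x) \<and> 0 \<le> y" by blast
  qed
  have "((\<lambda>t. G t0 / t * (1 / t)) \<longlongrightarrow> 0 * 0) at_top" by (intro tendsto_mult inv)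
  then have "\<forall>\<^sub>F t in at_top. - \<delta> < G t0 / t * (1 / t)"
    by (rule order_tendstoD) (use \<delta> in simp)
  with eventually_ge_at_top[of t0] show ?thesis
  proof eventually_elim
    case (elim t)
    have t: "t > 0" using elim(1) by (simp add: t0_def)
    have "G t / t\<^sup>2 \<ge> G t0 / t\<^sup>2" by (intro divide_right_mono G elim(1)) simp
    moreover have "g t / t\<^sup>2 = (a - \<delta>) + G t / t\<^sup>2" using t by (simp add: G_def diff_divide_distrib)
    moreover have "G t0 / t\<^sup>2 > - \<delta>" using elim(2) by (simp add: power2_eq_square)
    ultimately have "g t / t\<^sup>2 > a - 2 * \<delta>" by linarith
    then show ?case by (simp add: \<delta>_def diff_divide_distrib)
  qed
qed

lemma ballistic_bounds:
  fixes g h p q :: "real \<Rightarrow> real"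
  assumes dg: "\<And>t. (g has_real_derivative 2 * h t) (at t)"
    and dh: "\<And>t. (h has_real_derivative p t + q t) (at t)"
    and p: "continuous_on UNIV p" "\<And>t. p t \<ge> 0" and q: "null_average q"
    and g0: "\<And>t. g t \<ge> 0" and r: "r \<ge> 0"
  shows "ereal_sqrt (Liminf at_top (\<lambda>t. ereal (integral {0..t} p / t)))
      \<le> Liminf at_top (\<lambda>t. ereal (sqrt (r + g t) / t))" (is "ereal_sqrt ?l \<le> ?R")
    and "Limsup at_top (\<lambda>t. ereal (sqrt (r + g t) / t))
      \<le> ereal_sqrt (Limsup at_top (\<lambda>t. ereal (integral {0..t} p / t)))" (is "?S \<le> ereal_sqrt ?u")
proof -
  have P0: "\<forall>\<^sub>F t in at_top. 0 \<le> ereal (integral {0..t} p / t)"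
    using eventually_gt_at_top[of 0]
    by eventually_elim (auto intro!: divide_nonneg_pos integral_nonneg continuous_integrable p)
  then have l0: "0 \<le> ?l" by (rule Liminf_bounded)
  have u0: "0 \<le> ?u" using l0 Liminf_le_Limsup[of at_top "\<lambda>t. ereal (integral {0..t} p / t)"] by simp
  show "ereal_sqrt ?l \<le> ?R"
    unfolding le_Liminf_iff
  proof (intro allI impI)
    fix y assume y: "y < ereal_sqrt ?l"
    show "\<forall>\<^sub>F t in at_top. y < ereal (sqrt (r + g t) / t)"
    proof (cases "y < 0")
      case True
      show ?thesis using eventually_gt_at_top[of 0]
      proof eventually_elim
        case (elim t)
        have "0 \<le> ereal (sqrt (r + g t) / t)" using elim g0[of t] r by simp
        with True show ?case by (rule less_le_trans)
      qed
    next
      case False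
      obtain z where 2: "y = ereal z" "z \<ge> 0" using y False by (cases y) auto
      have *: "ereal (z\<^sup>2) < ?l"
      proof (cases ?l)
        case (real l')
        then have "z < sqrt l'" "l' \<ge> 0" using y 2 l0 by (auto simp: ereal_sqrt_def)
        then have "z\<^sup>2 < (sqrt l')\<^sup>2" using 2(2) by (intro power_strict_mono) auto
        with \<open>l' \<ge> 0\<close> real show ?thesis by simp
      qed (use l0 in auto)
      then obtain a where a: "z\<^sup>2 < a" "ereal a < ?l" using ereal_dense2[OF *] by auto
      have "\<forall>\<^sub>F t in at_top. a < integral {0..t} p / t" using less_LiminfD[OF a(2)] by simp
      then have "\<forall>\<^sub>F t in at_top. z\<^sup>2 < g t / t\<^sup>2"
        by (rule quadratic_lower_bound[OF dg dh p(1) q _ a(1)])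
      with eventually_gt_at_top[of 0] show ?thesis
      proof eventually_elim
        case (elim t)
        have "(z * t)\<^sup>2 < r + g t" using elim r by (simp add: power_mult_distrib pos_less_divide_eq)
        then have "z * t < sqrt (r + g t)" by (rule real_less_rsqrt)
        then show ?case using elim(1) 2 by (simp add: pos_less_divide_eq)
      qed
    qed
  qed
  show "?S \<le> ereal_sqrt ?u"
    unfolding Limsup_le_iff
  proof (intro allI impI)
    fix y assume y: "y > ereal_sqrt ?u"
    have s0: "0 \<le> ereal_sqrt ?u" using u0 by (cases ?u) (auto simp: ereal_sqrt_def)
    consider "y = \<infinity>" | z where "y = ereal z" "z > 0"
    proof (cases y)
      case (real z)
      have "0 < y" using s0 y by (rule le_less_trans)
      then show ?thesis using real that(2)[of z] by simp
    qed (use y s0 that(1) in auto)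
    then show "\<forall>\<^sub>F t in at_top. y > ereal (sqrt (r + g t) / t)"
    proof cases
      case (2 z)
      have *: "?u < ereal (z\<^sup>2)"
      proof (cases ?u)
        case (real u')
        then have "sqrt u' < z" "u' \<ge> 0" using y 2 u0 by (auto simp: ereal_sqrt_def)
        then have "(sqrt u')\<^sup>2 < z\<^sup>2" by (intro power_strict_mono) auto
        with \<open>u' \<ge> 0\<close> real show ?thesis by simp
      qed (use u0 y 2 in \<open>auto simp: ereal_sqrt_def\<close>)
      then obtain a where a: "?u < ereal a" "a < z\<^sup>2" using ereal_dense2[OF *] by auto
      define b where "b = (a + z\<^sup>2) / 2"
      have b: "a < b" "b < z\<^sup>2" using a(2) by (simp_all add: b_def)
      have "\<forall>\<^sub>F t in at_top. - a < integral {0..t} (\<lambda>s. - p s) / t"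
        using Limsup_lessD[OF a(1)] by simp
      \<comment> \<open>The upper bound is the lower bound for the negated functions.\<close>
      then have "\<forall>\<^sub>F t in at_top. - b < - g t / t\<^sup>2"
      proof (rule quadratic_lower_bound[rotated 4])
        show "((\<lambda>t. - g t) has_real_derivative 2 * - h t) (at t)" for t
          using DERIV_minus[OF dg[of t]] by simp
        show "((\<lambda>t. - h t) has_real_derivative - p t + - q t) (at t)" for t
          using DERIV_minus[OF dh[of t]] by simp
        show "null_average (\<lambda>t. - q t)" using null_average_cmult[OF q, of "-1"] by simp
      qed (use p b in \<open>auto intro: continuous_on_minus\<close>)
      moreover have "((\<lambda>t. r / t * (1 / t)) \<longlongrightarrow> 0 * 0) at_top"
        by (intro tendsto_mult tendsto_divide_0[OF tendsto_const filterlim_at_top_imp_at_infinity[OF filterlim_ident]])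
      then have "\<forall>\<^sub>F t in at_top. r / t * (1 / t) < z\<^sup>2 - b"
        by (rule order_tendstoD) (use b in simp)
      ultimately show ?thesis using eventually_gt_at_top[of 0]
      proof eventually_elim
        case (elim t)
        have "r / t\<^sup>2 < z\<^sup>2 - b" using elim(2) by (simp add: power2_eq_square)
        then have "(r + g t) / t\<^sup>2 < z\<^sup>2" using elim(1) unfolding add_divide_distrib by simp
        then have "r + g t < (z * t)\<^sup>2" using elim(3) by (simp add: pos_divide_less_eq power_mult_distrib)
        then have "sqrt (r + g t) < z * t" using elim(3) 2(2) by (intro real_less_lsqrt) (auto intro: less_imp_le)
        then show ?case using elim(3) 2 by (simp add: pos_divide_less_eq)
      qed
    qed simp
  qed
qed

lemma interval_lebesgue_integral_eq_integral:
  fixes p :: "real \<Rightarrow> real"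
  assumes "continuous_on UNIV p" "t \<ge> 0"
  shows "(LBINT s=0..t. p s) = integral {0..t} p"
proof -
  have "(LBINT s=ereal 0..ereal t. p s) = (LBINT s:{0..t}. p s)" by (rule interval_integral_Icc) (use assms in simp)
  also have "\<dots> = integral {0..t} p"
    by (rule set_borel_integral_eq_integral(2)[OF borel_integrable_atLeastAtMost'])
      (rule continuous_on_subset[OF assms(1)], simp)
  finally show ?thesis by (simp add: zero_ereal_def)
qed

lemma exp_curve_uminus:
  assumes "bounded_linear L"
  shows "exp_curve (\<lambda>x. - L x) t x = exp_curve L (- t) x"
proof -
  have "((\<lambda>x. - L x) ^^ k) x = (-1) ^ k *\<^sub>R (L ^^ k) x" for k
    by (induction k) (simp_all add: linear_simps[OF assms])
  moreover have "(- t) ^ k / fact k = t ^ k / fact k * (-1) ^ k" for k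
    by (subst power_minus) simp
  ultimately show ?thesis by (simp add: exp_curve_def)
qed

lemma toep_uminus: "toep (\<lambda>m. - a m) \<phi> = - toep a \<phi>"
proof -
  have "cscale (- z) \<psi> = - cscale z \<psi>" for z \<psi> by (rule cscale_left_linear(4))
  then show ?thesis unfolding toep_def op_series_def by (simp add: infsum_uminus)
qed

context smooth_symbol
begin

lemma continuous_velocity: "continuous_on UNIV (\<lambda>s. (norm (B (U s \<phi>)))\<^sup>2)"
  using bounded_clinear_B by (intro continuous_intros bounded_linear.continuous_on[of B] continuous_unitary_group[OF bounded_clinear_A selfadj_A])
    (simp add: bounded_clinear_def)

lemma ballistic_at_top:
  assumes "\<phi> \<in> dom_X"
  shows "ereal_sqrt (Liminf at_top (\<lambda>t. ereal (1 / t * (LBINT s=0..t. (norm (B (U s \<phi>)))\<^sup>2))))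
      \<le> Liminf at_top (\<lambda>t. ereal (1 / \<bar>t\<bar> * norm_X (U t \<phi>)))"
    and "Limsup at_top (\<lambda>t. ereal (1 / \<bar>t\<bar> * norm_X (U t \<phi>)))
      \<le> ereal_sqrt (Limsup at_top (\<lambda>t. ereal (1 / t * (LBINT s=0..t. (norm (B (U s \<phi>)))\<^sup>2))))"
proof -
  obtain h q where hq:
    "\<And>t. ((\<lambda>t. (norm (pos_X (U t \<phi>)))\<^sup>2) has_real_derivative 2 * h t) (at t)"
    "\<And>t. (h has_real_derivative (norm (B (U t \<phi>)))\<^sup>2 + q t) (at t)" "null_average q"
    using position_growth[OF assms] by blast
  let ?P = "\<lambda>t. ereal (integral {0..t} (\<lambda>s. (norm (B (U s \<phi>)))\<^sup>2) / t)"
  let ?N = "\<lambda>t. ereal (sqrt ((norm \<phi>)\<^sup>2 + (norm (pos_X (U t \<phi>)))\<^sup>2) / t)"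
  have P: "\<forall>\<^sub>F t in at_top. ereal (1 / t * (LBINT s=0..t. (norm (B (U s \<phi>)))\<^sup>2)) = ?P t"
    using eventually_gt_at_top[of 0]
    by eventually_elim (simp add: interval_lebesgue_integral_eq_integral continuous_velocity)
  have N: "\<forall>\<^sub>F t in at_top. ereal (1 / \<bar>t\<bar> * norm_X (U t \<phi>)) = ?N t"
    using eventually_gt_at_top[of 0]
    by eventually_elim (simp add: norm_X_def norm_unitary_group[OF bounded_clinear_A selfadj_A])
  note b = ballistic_bounds[OF hq(1,2) continuous_velocity _ hq(3), of "(norm \<phi>)\<^sup>2"]
  show "ereal_sqrt (Liminf at_top (\<lambda>t. ereal (1 / t * (LBINT s=0..t. (norm (B (U s \<phi>)))\<^sup>2))))
      \<le> Liminf at_top (\<lambda>t. ereal (1 / \<bar>t\<bar> * norm_X (U t \<phi>)))"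
    unfolding Liminf_eq[OF P] Liminf_eq[OF N] by (rule b(1)) auto
  show "Limsup at_top (\<lambda>t. ereal (1 / \<bar>t\<bar> * norm_X (U t \<phi>)))
      \<le> ereal_sqrt (Limsup at_top (\<lambda>t. ereal (1 / t * (LBINT s=0..t. (norm (B (U s \<phi>)))\<^sup>2))))"
    unfolding Limsup_eq[OF P] Limsup_eq[OF N] by (rule b(2)) auto
qed

text \<open>
  Reversing time amounts to negating the symbol.
\<close>

lemma ballistic_at_bot:
  assumes "\<phi> \<in> dom_X"
  shows "ereal_sqrt (Liminf at_bot (\<lambda>t. ereal (1 / t * (LBINT s=0..t. (norm (B (U s \<phi>)))\<^sup>2))))
      \<le> Liminf at_bot (\<lambda>t. ereal (1 / \<bar>t\<bar> * norm_X (U t \<phi>)))"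
    and "Limsup at_bot (\<lambda>t. ereal (1 / \<bar>t\<bar> * norm_X (U t \<phi>)))
      \<le> ereal_sqrt (Limsup at_bot (\<lambda>t. ereal (1 / t * (LBINT s=0..t. (norm (B (U s \<phi>)))\<^sup>2))))"
proof -
  interpret R: smooth_symbol "\<lambda>m. - c m" K
    by unfold_locales (simp_all add: herm decay)
  have "deriv_coeff (\<lambda>m. - c m) = (\<lambda>m. - deriv_coeff c m)" by (simp add: deriv_coeff_def fun_eq_iff)
  then have RB: "norm (R.B \<psi>) = norm (B \<psi>)" for \<psi> by (simp add: toep_uminus)
  have RU: "R.U t \<psi> = U (- t) \<psi>" for t \<psi>
    using exp_curve_uminus[OF bounded_linear_iA[OF bounded_clinear_A selfadj_A]] by (simp add: toep_uminus cscale_linear(4))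
  have "(LBINT s=0..ereal (- t). (norm (B (U s \<phi>)))\<^sup>2) = - (LBINT s=0..t. (norm (R.B (R.U s \<phi>)))\<^sup>2)" for t
    unfolding RB RU
    by (subst interval_integral_reflect, subst interval_integral_endpoints_reverse) simp
  then have P: "1 / (- t) * (LBINT s=0..ereal (- t). (norm (B (U s \<phi>)))\<^sup>2) = 1 / t * (LBINT s=0..t. (norm (R.B (R.U s \<phi>)))\<^sup>2)" for t
    by simp
  have N: "1 / \<bar>- t\<bar> * norm_X (U (- t) \<phi>) = 1 / \<bar>t\<bar> * norm_X (R.U t \<phi>)" for t by (simp add: RU)
  have inj: "inj (uminus :: real \<Rightarrow> real)" by simp
  show "ereal_sqrt (Liminf at_bot (\<lambda>t. ereal (1 / t * (LBINT s=0..t. (norm (B (U s \<phi>)))\<^sup>2))))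
      \<le> Liminf at_bot (\<lambda>t. ereal (1 / \<bar>t\<bar> * norm_X (U t \<phi>)))"
    unfolding at_bot_mirror Liminf_filtermap_eq[OF inj] P N by (rule R.ballistic_at_top(1)[OF assms])
  show "Limsup at_bot (\<lambda>t. ereal (1 / \<bar>t\<bar> * norm_X (U t \<phi>)))
      \<le> ereal_sqrt (Limsup at_bot (\<lambda>t. ereal (1 / t * (LBINT s=0..t. (norm (B (U s \<phi>)))\<^sup>2))))"
    unfolding at_bot_mirror Limsup_filtermap_eq[OF inj] P N by (rule R.ballistic_at_top(2)[OF assms])
qed

end

section \<open>Fourier coefficients of smooth functions\<close>

lemma fourier_coeff_eq_integral:
  assumes "continuous_on UNIV f"
  shows "fourier_coeff f m = 1 / (2 * pi) * integral {0..2*pi} (\<lambda>\<theta>. exp (- \<i> * of_int m * of_real \<theta>) * f \<theta>)"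
proof -
  have "continuous_on {0..2*pi} (\<lambda>\<theta>. exp (- \<i> * of_int m * of_real \<theta>) * f \<theta>)"
    by (intro continuous_intros continuous_on_subset[OF assms]) simp
  then show ?thesis
    unfolding fourier_coeff_def
    by (subst set_lebesgue_integral_eq_integral(2)[OF absolutely_integrable_continuous_real]) auto
qed

lemma fourier_coeff_cnj:
  fixes f :: "real \<Rightarrow> real"
  assumes "continuous_on UNIV f"
  shows "fourier_coeff (\<lambda>\<theta>. of_real (f \<theta>)) (- m) = cnj (fourier_coeff (\<lambda>\<theta>. of_real (f \<theta>)) m)"
proof -
  have c: "continuous_on UNIV (\<lambda>\<theta>. complex_of_real (f \<theta>))" by (intro continuous_intros assms)
  show ?thesis unfolding fourier_coeff_eq_integral[OF c] by (simp add: integral_cnj exp_cnj)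
qed

lemma fourier_coeff_deriv:
  fixes f f' :: "real \<Rightarrow> real"
  assumes d: "\<And>x. (f has_real_derivative f' x) (at x)" and f': "continuous_on UNIV f'"
    and per: "f (2 * pi) = f 0"
  shows "fourier_coeff (\<lambda>\<theta>. of_real (f' \<theta>)) m = \<i> * of_int m * fourier_coeff (\<lambda>\<theta>. of_real (f \<theta>)) m"
proof -
  let ?e = "\<lambda>\<theta>. exp (- \<i> * of_int m * complex_of_real \<theta>)"
  have f: "continuous_on UNIV f"
    by (rule continuous_at_imp_continuous_on) (use d DERIV_isCont in blast)
  have c: "continuous_on UNIV (\<lambda>\<theta>. complex_of_real (f \<theta>))" "continuous_on UNIV (\<lambda>\<theta>. complex_of_real (f' \<theta>))"
    by (intro continuous_intros f f')+
  have i: "(\<lambda>\<theta>. ?e \<theta> * of_real (f \<theta>)) integrable_on {0..2*pi}" "(\<lambda>\<theta>. ?e \<theta> * of_real (f' \<theta>)) integrable_on {0..2*pi}"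
    by (intro integrable_continuous_interval continuous_intros continuous_on_subset[OF f] continuous_on_subset[OF f']; simp)+
  have de: "(?e has_vector_derivative (- \<i> * of_int m) * ?e \<theta>) (at \<theta>)" for \<theta>
    by (auto intro!: derivative_eq_intros has_vector_derivative_real_field)
  have df: "((\<lambda>\<theta>. complex_of_real (f \<theta>)) has_vector_derivative of_real (f' \<theta>)) (at \<theta>)" for \<theta>
    using d by (simp add: has_real_derivative_iff_has_vector_derivative has_vector_derivative_of_real)
  have "((\<lambda>\<theta>. ?e \<theta> * of_real (f' \<theta>) + (- \<i> * of_int m) * ?e \<theta> * of_real (f \<theta>)) has_integral
      ?e (2 * pi) * of_real (f (2 * pi)) - ?e 0 * of_real (f 0)) {0..2*pi}"
    by (rule fundamental_theorem_of_calculus[OF _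
          has_vector_derivative_at_within[OF has_vector_derivative_mult[OF de df]]]) simp
  moreover have "?e (2 * pi) = 1"
  proof -
    have "?e (2 * pi) = exp (2 * of_int (- m) * pi * \<i>)" by (simp add: mult_ac)
    also have "\<dots> = 1" by (rule exp_integer_2pi) simp
    finally show ?thesis .
  qed
  ultimately have "integral {0..2*pi} (\<lambda>\<theta>. ?e \<theta> * of_real (f' \<theta>) + (- \<i> * of_int m) * (?e \<theta> * of_real (f \<theta>))) = 0"
    by (simp add: per mult.assoc integral_unique)
  then have "integral {0..2*pi} (\<lambda>\<theta>. ?e \<theta> * of_real (f' \<theta>)) + (- \<i> * of_int m) * integral {0..2*pi} (\<lambda>\<theta>. ?e \<theta> * of_real (f \<theta>)) = 0"
    unfolding integral_add[OF i(2) integrable_on_mult_right[OF i(1)]] integral_mult_right .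
  then have "integral {0..2*pi} (\<lambda>\<theta>. ?e \<theta> * of_real (f' \<theta>)) = \<i> * of_int m * integral {0..2*pi} (\<lambda>\<theta>. ?e \<theta> * of_real (f \<theta>))"
    by (simp add: add_eq_0_iff)
  then show ?thesis
    unfolding fourier_coeff_eq_integral[OF c(1)] fourier_coeff_eq_integral[OF c(2)] by (simp add: mult_ac)
qed

lemma fourier_coeff_bound:
  fixes f :: "real \<Rightarrow> real"
  assumes "continuous_on UNIV f"
  obtains K where "\<And>m. cmod (fourier_coeff (\<lambda>\<theta>. of_real (f \<theta>)) m) \<le> K"
proof -
  have c: "continuous_on UNIV (\<lambda>\<theta>. complex_of_real (f \<theta>))" by (intro continuous_intros assms)
  have "compact (f ` {0..2*pi})"
    by (intro compact_continuous_image continuous_on_subset[OF assms]) auto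
  then obtain K where "\<forall>y\<in>f ` {0..2*pi}. norm y \<le> K"
    using compact_imp_bounded bounded_iff by blast
  then have K: "\<bar>f x\<bar> \<le> K" if "x \<in> {0..2*pi}" for x using that by simp
  have "cmod (fourier_coeff (\<lambda>\<theta>. of_real (f \<theta>)) m) \<le> K" for m
  proof -
    have "norm (integral {0..2*pi} (\<lambda>\<theta>. exp (- \<i> * of_int m * of_real \<theta>) * complex_of_real (f \<theta>))) \<le> K * (2 * pi - 0)"
      by (rule integral_bound)
        (auto intro!: continuous_intros continuous_on_subset[OF assms] simp: norm_mult K)
    then show ?thesis
      unfolding fourier_coeff_eq_integral[OF c] by (simp add: norm_mult norm_divide divide_le_eq)
  qed
  then show ?thesis using that by blast
qed

lemma periodic2pi_deriv:
  assumes "periodic2pi f" "\<And>x. f differentiable (at x)"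
  shows "periodic2pi (deriv f)"
  unfolding periodic2pi_def
proof
  fix x
  have "(f has_real_derivative deriv f (x + 2 * pi)) (at (x + 2 * pi))"
    using assms(2) by (simp add: DERIV_deriv_iff_real_differentiable)
  then have "((\<lambda>x. f (x + 2 * pi)) has_real_derivative deriv f (x + 2 * pi)) (at x)"
    by (simp only: DERIV_shift)
  then show "deriv f (x + 2 * pi) = deriv f x"
    using assms(1) by (simp add: periodic2pi_def DERIV_imp_deriv)
qed

text \<open>
  Each derivative multiplies the coefficient of frequency \<open>m\<close> by \<open>i m\<close>, and the coefficients of
  the continuous third derivative are bounded.
\<close>

lemma C_torus_3_smooth_symbol:
  assumes "f \<in> C_torus 3"
  defines "c \<equiv> fourier_coeff (\<lambda>\<theta>. complex_of_real (f \<theta>))"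
  obtains K where "smooth_symbol c K" "\<And>m. fourier_coeff (\<lambda>\<theta>. complex_of_real (deriv f \<theta>)) m = deriv_coeff c m"
proof -
  define D where "D j = (deriv ^^ j) f" for j
  have D0: "D 0 = f" "D 1 = deriv f" by (simp_all add: D_def)
  have Ds: "D (Suc j) = deriv (D j)" for j by (simp add: D_def)
  have diff: "D j differentiable (at x)" if "j < 3" for j x
    using assms(1) that by (simp add: C_torus_def C_on_line_def D_def)
  have der: "(D j has_real_derivative D (Suc j) x) (at x)" if "j < 3" for j x
    using diff[OF that] by (simp add: Ds DERIV_deriv_iff_real_differentiable)
  have cont: "continuous_on UNIV (D j)" if "j \<le> 3" for j
  proof (cases "j = 3")
    case True
    then show ?thesis using assms(1) by (simp add: C_torus_def C_on_line_def D_def)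
  next
    case False
    then show ?thesis
      using that by (intro continuous_at_imp_continuous_on ballI DERIV_isCont[OF der]) auto
  qed
  have per: "periodic2pi (D j)" if "j \<le> 3" for j
    using that
  proof (induction j)
    case 0 then show ?case using assms(1) by (simp add: D0 C_torus_def)
  next
    case (Suc j) then show ?case unfolding Ds by (intro periodic2pi_deriv diff) auto
  qed
  have step: "fourier_coeff (\<lambda>\<theta>. of_real (D (Suc j) \<theta>)) m = \<i> * of_int m * fourier_coeff (\<lambda>\<theta>. of_real (D j \<theta>)) m"
    if "j < 3" for j m
  proof (rule fourier_coeff_deriv[OF der[OF that]])
    show "continuous_on UNIV (D (Suc j))" using that by (intro cont) simp
    show "D j (2 * pi) = D j 0" using per[of j] that by (metis periodic2pi_def add_0 less_imp_le)
  qed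
  obtain K where K: "\<And>m. cmod (fourier_coeff (\<lambda>\<theta>. of_real (D 3 \<theta>)) m) \<le> K"
    using fourier_coeff_bound[OF cont[of 3]] by auto
  have c3: "fourier_coeff (\<lambda>\<theta>. of_real (D 3 \<theta>)) m = (\<i> * of_int m) ^ 3 * c m" for m
    using step[of 0 m] step[of 1 m] step[of 2 m]
    by (simp add: c_def D0 numeral_2_eq_2 numeral_3_eq_3 mult.assoc)
  have "smooth_symbol c K"
  proof
    show "c (- m) = cnj (c m)" for m
      unfolding c_def using fourier_coeff_cnj[OF cont[of 0]] by (simp add: D0)
    show "cmod (c m) \<le> K / \<bar>real_of_int m\<bar> ^ 3" if "m \<noteq> 0" for m
    proof -
      have "\<bar>real_of_int m\<bar> ^ 3 * cmod (c m) \<le> K"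
        using K[of m] unfolding c3 by (simp add: norm_mult norm_power)
      then show ?thesis using that by (simp add: pos_le_divide_eq mult.commute)
    qed
  qed
  moreover have "fourier_coeff (\<lambda>\<theta>. complex_of_real (deriv f \<theta>)) m = deriv_coeff c m" for m
    using step[of 0 m] by (simp add: D0 c_def deriv_coeff_def Ds)
  ultimately show ?thesis using that by blast
qed

theorem proposition4p1:
  fixes f :: "real \<Rightarrow> real" and T T' :: "ell2 \<Rightarrow> ell2"
  assumes "f \<in> C_torus 3" and "\<not> f constant_on UNIV"
    and "T = toeplitz (\<lambda>\<theta>. complex_of_real (f \<theta>))"
    and "T' = toeplitz (\<lambda>\<theta>. complex_of_real (deriv f \<theta>))"
  shows "\<forall>\<phi>\<in>dom_X. \<forall>F\<in>{at_top, at_bot}.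
    ereal_sqrt (Liminf F (\<lambda>t. ereal (1 / t * (LBINT s=0..t. (norm (T' (exp_i T s \<phi>)))\<^sup>2))))
      \<le> Liminf F (\<lambda>t. ereal (1 / \<bar>t\<bar> * norm_X (exp_i T t \<phi>))) \<and>
    Limsup F (\<lambda>t. ereal (1 / \<bar>t\<bar> * norm_X (exp_i T t \<phi>)))
      \<le> ereal_sqrt (Limsup F (\<lambda>t. ereal (1 / t * (LBINT s=0..t. (norm (T' (exp_i T s \<phi>)))\<^sup>2))))"
proof -
  define c where "c = fourier_coeff (\<lambda>\<theta>. complex_of_real (f \<theta>))"
  obtain K where K: "smooth_symbol c K"
    "\<And>m. fourier_coeff (\<lambda>\<theta>. complex_of_real (deriv f \<theta>)) m = deriv_coeff c m"
    using C_torus_3_smooth_symbol[OF assms(1)] unfolding c_def by blast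
  interpret smooth_symbol c K by (rule K(1))
  have T: "T = A" unfolding assms(3) by (rule toeplitz_eq_toep[OF l1c]) (simp add: c_def)
  have T': "T' = B" unfolding assms(4) by (rule toeplitz_eq_toep[OF l1b K(2)])
  show ?thesis
    unfolding T T' exp_i_eq[OF bounded_clinear_A]
    using ballistic_at_top ballistic_at_bot by simp
qed

end
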